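(* Let $V=(V_t)_{t\ge 0}$ be a strongly continuous one-parameter semigroup of isometries on a separable Hilbert space $\mathcal{H}$, and let $D(t)$, $t>0$, be the set of decomposable vectors at $t$ of the product system of the CCR flow $\alpha^V$ on $B(\Gamma(\mathcal{H}))$. Fix $t>0$ and suppose $x\in D(t)$. Then there exist $\xi\in \mathrm{Ker}(V_t^* )$ and $\lambda\in\mathbb{C}\setminus\{0\}$ such that $x=\lambda T^{(t)}_{e(\xi)}$.
   Context: Inner products are linear in the first variable. $\Gamma(\mathcal{H})$ is the symmetric Fock space of $\mathcal{H}$, with exponential vectors $e(\eta)$, $\eta\in\mathcal{H}$, satisfying $\langle e(\xi)|e(\eta)\rangle=e^{\langle\xi|\eta\rangle}$. The Weyl operators are the unitaries $W(\xi)$, $\xi\in\mathcal{H}$, with $W(\xi)e(\eta)=e^{-\frac{\|\xi\|^2}{2}-\langle\eta|\xi\rangle}e(\xi+\eta)$. The CCR flow $\alpha^V=\{\alpha_t\}_{t\ge0}$ is the unique semigroup of unital normal $*$-endomorphisms of $B(\Gamma(\mathcal{H}))$ (an $E_0$-semigroup) such that $\alpha_t(W(\xi))=W(V_t\xi)$ for all $t\ge 0$, $\xi\in\mathcal{H}$. The product system of $\alpha=\alpha^V$ has fibres $E(t)=\{T\in B(\Gamma(\mathcal{H})):\alpha_t(A)T=TA\ \text{for all }A\in B(\Gamma(\mathcal{H}))\}$ for $t>0$, a Hilbert space with inner product determined by $\langle S|T\rangle 1=T^*S$; operator composition gives the multiplication $E(s)\times E(t)\to E(s+t)$. $D(t)$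 is the set of decomposable vectors in $E(t)$: a nonzero $u\in E(t)$ is decomposable if for every $0<s<t$ there exist $v\in E(s)$ and $w\in E(t-s)$ with $u=vw$. For $\xi\in\mathrm{Ker}(V_t^* )$, $T^{(t)}_{e(\xi)}\in B(\Gamma(\mathcal{H}))$ is the bounded operator determined by $T^{(t)}_{e(\xi)}e(\eta)=e(\xi+V_t\eta)$ for $\eta\in\mathcal{H}$. *)

theory Defs
  imports "HOL-Analysis.Analysis"
begin

section \<open>Complex Hilbert spaces\<close>

text \<open>The inner product is linear in the first variable. The last axiom contains positivity and
  definiteness, and says that the norm is the one induced by the inner product.\<close>

class complex_inner = real_normed_vector +
  fixes scaleC :: "complex \<Rightarrow> 'a \<Rightarrow> 'a"
    and cinner :: "'a \<Rightarrow> 'a \<Rightarrow> complex"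
  assumes scaleC_add_right: "scaleC a (x + y) = scaleC a x + scaleC a y"
    and scaleC_add_left: "scaleC (a + b) x = scaleC a x + scaleC b x"
    and scaleC_scaleC: "scaleC a (scaleC b x) = scaleC (a * b) x"
    and scaleC_of_real: "scaleC (of_real r) x = r *\<^sub>R x"
    and cinner_add_left: "cinner (x + y) z = cinner x z + cinner y z"
    and cinner_scaleC_left: "cinner (scaleC a x) y = a * cinner x y"
    and cinner_commute: "cinner x y = cnj (cinner y x)"
    and cinner_self: "cinner x x = of_real ((norm x)\<^sup>2)"

class chilbert_space = complex_inner + banach

global_interpretation complex_vector: vector_space "scaleC :: complex \<Rightarrow> 'a \<Rightarrow> 'a :: complex_inner"
proof
  show "scaleC 1 x = x" for x :: 'a
    using scaleC_of_real[of 1 x] by simp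
qed (simp_all add: scaleC_add_right scaleC_add_left scaleC_scaleC)

lemma cinner_zero_left [simp]: "cinner 0 (y::'a::complex_inner) = 0"
  using cinner_add_left[of 0 0 y] by simp

lemma cinner_zero_right [simp]: "cinner (y::'a::complex_inner) 0 = 0"
  by (metis cinner_commute cinner_zero_left complex_cnj_zero)

lemma cinner_add_right: "cinner (x::'a::complex_inner) (y + z) = cinner x y + cinner x z"
  by (metis cinner_add_left cinner_commute complex_cnj_add)

lemma cinner_scaleC_right: "cinner (x::'a::complex_inner) (scaleC a y) = cnj a * cinner x y"
  by (metis cinner_scaleC_left cinner_commute complex_cnj_mult)

lemma cinner_scaleR_left: "cinner (r *\<^sub>R (x::'a::complex_inner)) y = of_real r * cinner x y"
  by (metis cinner_scaleC_left scaleC_of_real)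

lemma cinner_scaleR_right: "cinner (x::'a::complex_inner) (r *\<^sub>R y) = of_real r * cinner x y"
  by (metis cinner_scaleC_right scaleC_of_real complex_cnj_complex_of_real)

lemma cinner_sum_left: "cinner (\<Sum>i\<in>A. f i) (y::'a::complex_inner) = (\<Sum>i\<in>A. cinner (f i) y)"
  by (induction A rule: infinite_finite_induct) (simp_all add: cinner_add_left)

lemma cinner_sum_right: "cinner (y::'a::complex_inner) (\<Sum>i\<in>A. f i) = (\<Sum>i\<in>A. cinner y (f i))"
  by (induction A rule: infinite_finite_induct) (simp_all add: cinner_add_right)

lemma cinner_Re: "Re (cinner x y) = ((norm (x + y))\<^sup>2 - (norm x)\<^sup>2 - (norm (y::'a::complex_inner))\<^sup>2) / 2"
proof -
  have "Re (cinner (x + y) (x + y)) = (norm (x + y))\<^sup>2"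
    by (simp only: cinner_self Re_complex_of_real)
  moreover have "Re (cinner (x + y) (x + y)) = (norm x)\<^sup>2 + 2 * Re (cinner x y) + (norm y)\<^sup>2"
    unfolding cinner_add_left cinner_add_right cinner_self[of x] cinner_self[of y]
      cinner_commute[of y x] plus_complex.sel Re_complex_of_real complex_cnj by simp
  ultimately show ?thesis by simp
qed

lemma tendsto_cinner:
  assumes "(f \<longlongrightarrow> x) F" "(g \<longlongrightarrow> (y::'a::complex_inner)) F"
  shows "((\<lambda>n. cinner (f n) (g n)) \<longlongrightarrow> cinner x y) F"
proof -
  have *: "((\<lambda>n. Re (cinner (f n) (g n))) \<longlongrightarrow> Re (cinner x y)) F"
    if "(f \<longlongrightarrow> x) F" "(g \<longlongrightarrow> (y::'a::complex_inner)) F" for f g x y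
    unfolding cinner_Re by (intro tendsto_intros that) simp
  have n: "norm (scaleC \<i> z) = norm z" for z :: 'a
  proof -
    have "complex_of_real ((norm (scaleC \<i> z))\<^sup>2) = complex_of_real ((norm z)\<^sup>2)"
      unfolding cinner_self[symmetric] by (simp add: cinner_scaleC_left cinner_scaleC_right)
    then show ?thesis
      using of_real_eq_iff[of "(norm (scaleC \<i> z))\<^sup>2" "(norm z)\<^sup>2"] power2_eq_iff_nonneg by auto
  qed
  have g: "((\<lambda>n. scaleC \<i> (g n)) \<longlongrightarrow> scaleC \<i> y) F"
    using assms(2) unfolding tendsto_iff dist_norm
    by (simp add: n flip: complex_vector.scale_right_diff_distrib)
  have Im: "Im (cinner a b) = Re (cinner a (scaleC \<i> b))" for a b :: 'a
    by (simp add: cinner_scaleC_right)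
  show ?thesis
    unfolding tendsto_complex_iff using *[OF assms] *[OF assms(1) g] by (simp add: Im)
qed

section \<open>Bounded operators\<close>

definition bounded_op :: "('a::complex_inner \<Rightarrow> 'b::complex_inner) set" where
  "bounded_op = {A. bounded_linear A \<and> (\<forall>c x. A (scaleC c x) = scaleC c (A x))}"

definition op_scale :: "complex \<Rightarrow> ('a \<Rightarrow> 'b::complex_inner) \<Rightarrow> 'a \<Rightarrow> 'b" where
  "op_scale c A = (\<lambda>x. scaleC c (A x))"

definition op_add :: "('a \<Rightarrow> 'b::complex_inner) \<Rightarrow> ('a \<Rightarrow> 'b) \<Rightarrow> 'a \<Rightarrow> 'b" where
  "op_add A B = (\<lambda>x. A x + B x)"

definition cadjoint :: "('a::complex_inner \<Rightarrow> 'b::complex_inner) \<Rightarrow> 'b \<Rightarrow> 'a" where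
  "cadjoint A = (THE B. B \<in> bounded_op \<and> (\<forall>x y. cinner (A x) y = cinner x (B y)))"

definition isometry_op :: "('a::complex_inner \<Rightarrow> 'b::complex_inner) \<Rightarrow> bool" where
  "isometry_op A \<longleftrightarrow> A \<in> bounded_op \<and> (\<forall>x. norm (A x) = norm x)"

definition unitary_op :: "('a::complex_inner \<Rightarrow> 'a) \<Rightarrow> bool" where
  "unitary_op U \<longleftrightarrow> U \<in> bounded_op \<and> cadjoint U \<circ> U = id \<and> U \<circ> cadjoint U = id"

definition self_adjoint_op :: "('a::complex_inner \<Rightarrow> 'a) set" where
  "self_adjoint_op = {A \<in> bounded_op. cadjoint A = A}"

definition op_le :: "('a::complex_inner \<Rightarrow> 'a) \<Rightarrow> ('a \<Rightarrow> 'a) \<Rightarrow> bool" where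
  "op_le A B \<longleftrightarrow> (\<forall>x. cinner (B x - A x) x \<in> \<real>\<^sub>\<ge>\<^sub>0)"

definition is_op_sup :: "('a::complex_inner \<Rightarrow> 'a) set \<Rightarrow> ('a \<Rightarrow> 'a) \<Rightarrow> bool" where
  "is_op_sup \<A> S \<longleftrightarrow> S \<in> self_adjoint_op \<and> (\<forall>A\<in>\<A>. op_le A S) \<and>
     (\<forall>B\<in>self_adjoint_op. (\<forall>A\<in>\<A>. op_le A B) \<longrightarrow> op_le S B)"

text \<open>Endomorphisms of \<open>B(K)\<close> are represented by functions on all maps \<open>K \<Rightarrow> K\<close>; only their values
  on bounded operators are constrained or used.\<close>

definition unital_star_endomorphism ::
    "(('a::complex_inner \<Rightarrow> 'a) \<Rightarrow> ('a \<Rightarrow> 'a)) \<Rightarrow> bool" where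
  "unital_star_endomorphism \<theta> \<longleftrightarrow>
     (\<forall>A\<in>bounded_op. \<theta> A \<in> bounded_op) \<and>
     (\<forall>A\<in>bounded_op. \<forall>B\<in>bounded_op. \<theta> (op_add A B) = op_add (\<theta> A) (\<theta> B)) \<and>
     (\<forall>c. \<forall>A\<in>bounded_op. \<theta> (op_scale c A) = op_scale c (\<theta> A)) \<and>
     (\<forall>A\<in>bounded_op. \<forall>B\<in>bounded_op. \<theta> (A \<circ> B) = \<theta> A \<circ> \<theta> B) \<and>
     (\<forall>A\<in>bounded_op. \<theta> (cadjoint A) = cadjoint (\<theta> A)) \<and>
     \<theta> id = id"

text \<open>Normality: suprema of bounded upward directed families of self-adjoint operators are
  preserved.\<close>

definition normal_map :: "(('a::complex_inner \<Rightarrow> 'a) \<Rightarrow> ('a \<Rightarrow> 'a)) \<Rightarrow> bool" where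
  "normal_map \<theta> \<longleftrightarrow>
     (\<forall>\<A> S. \<A> \<noteq> {} \<and> \<A> \<subseteq> self_adjoint_op \<and>
        (\<forall>A\<in>\<A>. \<forall>B\<in>\<A>. \<exists>C\<in>\<A>. op_le A C \<and> op_le B C) \<and> is_op_sup \<A> S
        \<longrightarrow> is_op_sup (\<theta> ` \<A>) (\<theta> S))"

definition isometry_semigroup :: "(real \<Rightarrow> 'h::complex_inner \<Rightarrow> 'h) \<Rightarrow> bool" where
  "isometry_semigroup V \<longleftrightarrow>
     (\<forall>t\<ge>0. isometry_op (V t)) \<and> V 0 = id \<and>
     (\<forall>s\<ge>0. \<forall>t\<ge>0. V (s + t) = V s \<circ> V t) \<and>
     (\<forall>x. continuous_on {0..} (\<lambda>t. V t x))"

section \<open>Symmetric Fock space\<close>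

text \<open>The Hilbert space \<open>'f\<close> is the symmetric Fock space of \<open>'h\<close>, that is, the Hilbert space direct
  sum over \<open>n\<close> of the symmetric \<open>n\<close>-fold tensor powers of \<open>'h\<close>. Here \<open>\<Phi> [x\<^sub>1, \<dots>, x\<^sub>n]\<close> stands for the
  symmetrised elementary tensor \<open>P\<^sub>n (x\<^sub>1 \<otimes> \<dots> \<otimes> x\<^sub>n)\<close>, where \<open>P\<^sub>n\<close> is the projection
  averaging over all permutations of the factors, and \<open>\<Phi> []\<close> is the vacuum. The Gram matrix and
  totality determine \<open>('f, \<Phi>)\<close> up to a unique unitary; in particular they imply that \<open>\<Phi>\<close>
  is symmetric and multilinear on lists of each length.\<close>

definition symmetric_fock_space :: "('h::complex_inner list \<Rightarrow> 'f::chilbert_space) \<Rightarrow> bool" where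
  "symmetric_fock_space \<Phi> \<longleftrightarrow>
     (\<forall>xs ys. cinner (\<Phi> xs) (\<Phi> ys) =
        (if length xs = length ys
         then (\<Sum>\<sigma> | \<sigma> permutes {..<length xs}. \<Prod>i<length xs. cinner (xs ! i) (ys ! \<sigma> i))
                / fact (length xs)
         else 0)) \<and>
     closure (complex_vector.span (range \<Phi>)) = UNIV"

definition expvec :: "('h list \<Rightarrow> 'f::chilbert_space) \<Rightarrow> 'h \<Rightarrow> 'f" where
  "expvec \<Phi> \<eta> = (\<Sum>n. (1 / sqrt (fact n)) *\<^sub>R \<Phi> (replicate n \<eta>))"

lemma fock_power:
  assumes "symmetric_fock_space \<Phi>"
  shows "cinner (\<Phi> (replicate m \<xi>)) (\<Phi> (replicate n \<eta>)) = (if m = n then cinner \<xi> \<eta> ^ n else 0)"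
proof -
  have "(\<Prod>i<n. cinner (replicate n \<xi> ! i) (replicate n \<eta> ! \<sigma> i)) = cinner \<xi> \<eta> ^ n"
    if "\<sigma> permutes {..<n}" for \<sigma>
  proof -
    have "cinner (replicate n \<xi> ! i) (replicate n \<eta> ! \<sigma> i) = cinner \<xi> \<eta>" if "i < n" for i
      using permutes_in_image[OF \<open>\<sigma> permutes {..<n}\<close>, of i] that by simp
    then have "(\<Prod>i<n. cinner (replicate n \<xi> ! i) (replicate n \<eta> ! \<sigma> i)) = (\<Prod>i<n. cinner \<xi> \<eta>)"
      by (intro prod.cong) auto
    then show ?thesis by simp
  qed
  then have "(\<Sum>\<sigma> | \<sigma> permutes {..<n}. \<Prod>i<n. cinner (replicate n \<xi> ! i) (replicate n \<eta> ! \<sigma> i))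
     = fact n * cinner \<xi> \<eta> ^ n"
    by (simp add: card_permutations[of "{..<n}" n])
  then show ?thesis
    using assms unfolding symmetric_fock_space_def by simp
qed

lemma expvec_sums:
  assumes "symmetric_fock_space \<Phi>"
  shows "(\<lambda>n. (1 / sqrt (fact n)) *\<^sub>R \<Phi> (replicate n \<eta>)) sums expvec \<Phi> \<eta>"
proof -
  have nn: "norm (\<Phi> (replicate n \<eta>)) = norm \<eta> ^ n" for n
  proof -
    have "complex_of_real ((norm (\<Phi> (replicate n \<eta>)))\<^sup>2) = complex_of_real (norm \<eta> ^ n)^2"
      unfolding cinner_self[symmetric] fock_power[OF assms]
      by (simp add: cinner_self power_mult[symmetric] mult.commute)
    then have "(norm (\<Phi> (replicate n \<eta>)))\<^sup>2 = (norm \<eta> ^ n)^2"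
      using of_real_eq_iff[where 'a=complex] by (metis of_real_power)
    then show ?thesis by (simp add: power2_eq_iff_nonneg)
  qed
  let ?a = "\<lambda>n. norm \<eta> ^ n / sqrt (fact n)"
  obtain N :: nat where N: "(2 * norm \<eta>)\<^sup>2 \<le> real N" using real_arch_simple by blast
  have "summable ?a"
  proof (rule summable_ratio_test[of "1/2" N])
    fix n assume "N \<le> n"
    then have "(2 * norm \<eta>)\<^sup>2 \<le> real (Suc n)" using N by simp
    then have "2 * norm \<eta> \<le> sqrt (real (Suc n))" by (simp add: real_le_rsqrt)
    then have "norm \<eta> / sqrt (real (Suc n)) \<le> 1/2" by (simp add: field_simps)
    then have "norm \<eta> / sqrt (real (Suc n)) * ?a n \<le> 1/2 * ?a n"
      by (intro mult_right_mono) auto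
    moreover have "norm (?a (Suc n)) = norm \<eta> / sqrt (real (Suc n)) * ?a n"
      by (simp only: fact_Suc real_sqrt_mult power_Suc of_nat_mult of_nat_fact) simp
    moreover have "norm (?a n) = ?a n" by simp
    ultimately show "norm (?a (Suc n)) \<le> 1/2 * norm (?a n)" by (simp only:)
  qed simp
  then have "summable (\<lambda>n. norm ((1 / sqrt (fact n)) *\<^sub>R \<Phi> (replicate n \<eta>)))"
    by (simp add: nn)
  then show ?thesis
    unfolding expvec_def by (rule summable_sums[OF summable_norm_cancel])
qed

lemma cinner_expvec:
  assumes "symmetric_fock_space \<Phi>"
  shows "cinner (expvec \<Phi> \<xi>) (expvec \<Phi> \<eta>) = exp (cinner \<xi> \<eta>)"
proof -
  have sq: "complex_of_real (sqrt (fact k)) * complex_of_real (sqrt (fact k)) = fact k" for k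
    by (simp flip: of_real_mult)
  let ?s = "\<lambda>\<eta> n. \<Sum>i<n. (1 / sqrt (fact i)) *\<^sub>R \<Phi> (replicate i \<eta>)"
  have "(\<lambda>n. cinner (?s \<xi> n) (?s \<eta> n)) \<longlonglongrightarrow> cinner (expvec \<Phi> \<xi>) (expvec \<Phi> \<eta>)"
    using expvec_sums[OF assms] unfolding sums_def by (intro tendsto_cinner)
  moreover have "cinner (?s \<xi> n) (?s \<eta> n) = (\<Sum>i<n. cinner \<xi> \<eta> ^ i /\<^sub>R fact i)" for n
  proof -
    have "cinner (?s \<xi> n) (?s \<eta> n) =
       (\<Sum>i<n. \<Sum>j<n. if i = j then of_real (1 / sqrt (fact i) * (1 / sqrt (fact i))) * cinner \<xi> \<eta> ^ i else 0)"
      unfolding cinner_sum_left cinner_sum_right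
      by (subst sum.swap) (intro sum.cong refl, simp add: cinner_scaleR_left cinner_scaleR_right fock_power[OF assms] sq)
    also have "\<dots> = (\<Sum>i<n. cinner \<xi> \<eta> ^ i /\<^sub>R fact i)"
      by (rule sum.cong) (simp_all add: scaleR_conv_of_real divide_inverse mult.commute flip: of_real_mult inverse_mult_distrib)
    finally show ?thesis .
  qed
  ultimately have "(\<lambda>i. cinner \<xi> \<eta> ^ i /\<^sub>R fact i) sums cinner (expvec \<Phi> \<xi>) (expvec \<Phi> \<eta>)"
    unfolding sums_def by simp
  then show ?thesis using exp_converges sums_unique2 by blast
qed

definition weyl ::
    "('h::complex_inner list \<Rightarrow> 'f::chilbert_space) \<Rightarrow> 'h \<Rightarrow> 'f \<Rightarrow> 'f" where
  "weyl \<Phi> \<xi> = (THE U. unitary_op U \<and>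
     (\<forall>\<eta>. U (expvec \<Phi> \<eta>) =
        scaleC (exp (- of_real ((norm \<xi>)\<^sup>2 / 2) - cinner \<eta> \<xi>)) (expvec \<Phi> (\<xi> + \<eta>))))"

section \<open>The CCR flow and its product system\<close>

text \<open>A normal unital endomorphism is determined by its values on the Weyl operators, so \<open>\<alpha>\<close> is
  unique on bounded operators; its continuity in the time parameter is a consequence of that of \<open>V\<close>.\<close>

definition ccr_flow :: "('h::complex_inner list \<Rightarrow> 'f::chilbert_space) \<Rightarrow> (real \<Rightarrow> 'h \<Rightarrow> 'h) \<Rightarrow>
    (real \<Rightarrow> ('f \<Rightarrow> 'f) \<Rightarrow> ('f \<Rightarrow> 'f)) \<Rightarrow> bool" where
  "ccr_flow \<Phi> V \<alpha> \<longleftrightarrow>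
     (\<forall>t\<ge>0. unital_star_endomorphism (\<alpha> t) \<and> normal_map (\<alpha> t)) \<and>
     (\<forall>A\<in>bounded_op. \<alpha> 0 A = A) \<and>
     (\<forall>s\<ge>0. \<forall>t\<ge>0. \<forall>A\<in>bounded_op. \<alpha> (s + t) A = \<alpha> s (\<alpha> t A)) \<and>
     (\<forall>t\<ge>0. \<forall>\<xi>. \<alpha> t (weyl \<Phi> \<xi>) = weyl \<Phi> (V t \<xi>))"

definition product_fibre ::
    "(real \<Rightarrow> ('f::complex_inner \<Rightarrow> 'f) \<Rightarrow> ('f \<Rightarrow> 'f)) \<Rightarrow> real \<Rightarrow> ('f \<Rightarrow> 'f) set" where
  "product_fibre \<alpha> t = {T \<in> bounded_op. \<forall>A\<in>bounded_op. \<alpha> t A \<circ> T = T \<circ> A}"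

definition decomposable_vectors ::
    "(real \<Rightarrow> ('f::complex_inner \<Rightarrow> 'f) \<Rightarrow> ('f \<Rightarrow> 'f)) \<Rightarrow> real \<Rightarrow> ('f \<Rightarrow> 'f) set" where
  "decomposable_vectors \<alpha> t =
     {u \<in> product_fibre \<alpha> t. u \<noteq> (\<lambda>_. 0) \<and>
        (\<forall>s. 0 < s \<and> s < t \<longrightarrow>
           (\<exists>v\<in>product_fibre \<alpha> s. \<exists>w\<in>product_fibre \<alpha> (t - s). u = v \<circ> w))}"

text \<open>The operator \<open>T\<^bsub>e(\<xi>)\<^esub>\<^bsup>(t)\<^esup>\<close> is \<open>exp_op \<Phi> (V t) \<xi>\<close>; it is meaningful for \<open>\<xi>\<close> in the kernel of
  the adjoint of \<open>V t\<close>.\<close>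

definition exp_op :: "('h::complex_inner list \<Rightarrow> 'f::chilbert_space) \<Rightarrow> ('h \<Rightarrow> 'h) \<Rightarrow> 'h \<Rightarrow> 'f \<Rightarrow> 'f" where
  "exp_op \<Phi> S \<xi> = (THE T. T \<in> bounded_op \<and> (\<forall>\<eta>. T (expvec \<Phi> \<eta>) = expvec \<Phi> (\<xi> + S \<eta>)))"

end

theory Submission
  imports Defs
begin

text \<open>Let \<open>\<Omega> = e(0)\<close> and, for \<open>T\<close> in the fibre \<open>E(t)\<close>, let \<open>\<phi>(\<zeta>) = \<langle>e(\<zeta>)|T\<Omega>\<rangle>\<close> be its amplitude. The
  relation \<open>T W(\<eta>) = W(V\<^sub>t \<eta>) T\<close> gives
  \<open>\<langle>T e(\<eta>)|e(\<zeta>)\<rangle> = exp \<langle>V\<^sub>t \<eta>|\<zeta>\<rangle> \<cdot> cnj (\<phi>(\<zeta> - V\<^sub>t \<eta>))\<close>. The left-hand side is holomorphic along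
  complex lines in \<open>\<eta>\<close>, and so is \<open>\<phi>(\<zeta> - V\<^sub>t \<eta>)\<close> itself; a function that is holomorphic together
  with its conjugate is constant, so \<open>\<phi>\<close> does not change under translation by the range of \<open>V\<^sub>t\<close>
  (\<open>amplitude_shift\<close>). It follows that \<open>T\<^sup>* e(\<zeta>) = \<phi>(\<zeta>) e(V\<^sub>t\<^sup>* \<zeta>)\<close>, so \<open>T\<close> is determined by \<open>\<phi>\<close>, and
  a product \<open>x = v w\<close> has the amplitude \<open>\<phi>\<^sub>x(\<zeta>) = \<phi>\<^sub>v(\<zeta>) \<phi>\<^sub>w(V\<^sub>s\<^sup>* \<zeta>)\<close> (\<open>amplitude_comp\<close>). Hence the
  amplitude of a decomposable \<open>x\<close> splits, for every \<open>s \<le> t\<close>, into a factor that depends on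
  \<open>\<zeta> - Q\<^sub>s \<zeta>\<close> and one that depends on \<open>Q\<^sub>s \<zeta>\<close>, where \<open>Q\<^sub>s = V\<^sub>s V\<^sub>s\<^sup>*\<close>.

  The projections \<open>Q\<^sub>s\<close> decrease strongly continuously in \<open>s\<close>, so \<open>\<zeta> - Q\<^sub>t \<zeta>\<close> can be cut into
  arbitrarily small orthogonal pieces \<open>\<zeta>\<^sub>i\<close>, and this has two consequences. First, \<open>\<phi>(0) \<noteq> 0\<close>
  (\<open>vacuum_amplitude_nonzero\<close>): choose \<open>\<omega>\<close> with \<open>\<phi>(\<omega>) \<noteq> 0\<close>. If deleting from \<open>\<omega>\<close> its component over
  some interval produced a zero of \<open>\<phi>\<close>, then so would deleting the component over one of the two
  halves, and nested bisection would produce zeros of \<open>\<phi>\<close> converging to \<open>\<omega>\<close>. Second, after scaling to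
  \<open>\<phi>(0) = 1\<close>, the amplitude is the product of the \<open>\<phi>(\<zeta>\<^sub>i)\<close>, and \<open>\<phi>(\<zeta>\<^sub>i) = 1 + \<langle>\<zeta>\<^sub>i|\<xi>\<rangle> + \<langle>r(\<zeta>\<^sub>i)|T\<Omega>\<rangle>\<close>, where
  \<open>\<xi>\<close> represents the one-particle component of \<open>T\<Omega>\<close> and \<open>r(\<zeta>\<^sub>i)\<close> is the part of \<open>e(\<zeta>\<^sub>i)\<close> of particle
  number at least two. The \<open>r(\<zeta>\<^sub>i)\<close> are pairwise orthogonal and \<open>\<parallel>r(\<zeta>\<^sub>i)\<parallel> \<le> \<parallel>\<zeta>\<^sub>i\<parallel>\<^sup>2\<close>, so their sum has norm
  at most \<open>max \<parallel>\<zeta>\<^sub>i\<parallel> \<cdot> \<parallel>\<zeta>\<parallel>\<close> and disappears in the limit (\<open>log_phi_approx\<close>). What remains is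
  \<open>\<phi>(\<zeta>) = exp \<langle>\<zeta> - Q\<^sub>t \<zeta>|\<xi>\<rangle>\<close>, the amplitude of the exponential vector of \<open>\<xi> - Q\<^sub>t \<xi> \<in> Ker V\<^sub>t\<^sup>*\<close>.

  Both the Weyl operators and the operators \<open>T\<^bsub>e(\<xi>)\<^esub>\<close> are defined by their values on exponential
  vectors, so all of this rests on the totality of these vectors (\<open>expvec_total\<close>) and on the
  extension of isometries from total sets (\<open>isometric_extension\<close>).\<close>

section \<open>Complex Hilbert spaces\<close>

lemma cinner_minus_left: "cinner (- x) (y::'a::complex_inner) = - cinner x y"
  using cinner_scaleR_left[of "-1" x y] by simp

lemma cinner_minus_right: "cinner x (- (y::'a::complex_inner)) = - cinner x y"
  using cinner_scaleR_right[of x "-1" y] by simp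

lemma cinner_diff_left: "cinner (x - z) (y::'a::complex_inner) = cinner x y - cinner z y"
  using cinner_add_left[of x "- z" y] by (simp add: cinner_minus_left)

lemma cinner_diff_right: "cinner x (y - (z::'a::complex_inner)) = cinner x y - cinner x z"
  using cinner_add_right[of x y "- z"] by (simp add: cinner_minus_right)

lemma norm_sq_cinner: "(norm (x::'a::complex_inner))\<^sup>2 = Re (cinner x x)"
  by (simp only: cinner_self Re_complex_of_real)

lemma norm_add_sq: "(norm (x + y))\<^sup>2 = (norm x)\<^sup>2 + (norm (y::'a::complex_inner))\<^sup>2 + 2 * Re (cinner x y)"
  using cinner_Re[of x y] by simp

lemma norm_diff_sq: "(norm (x - y))\<^sup>2 = (norm x)\<^sup>2 + (norm (y::'a::complex_inner))\<^sup>2 - 2 * Re (cinner x y)"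
  using norm_add_sq[of x "- y"] by (simp add: cinner_minus_right)

lemma Im_cinner: "Im (cinner x y) = Re (cinner x (scaleC \<i> (y::'a::complex_inner)))"
  by (simp add: cinner_scaleC_right)

lemma norm_scaleC: "norm (scaleC a (x::'a::complex_inner)) = cmod a * norm x"
proof -
  have "cinner (scaleC a x) (scaleC a x) = a * cnj a * of_real ((norm x)\<^sup>2)"
    by (simp add: cinner_scaleC_left cinner_scaleC_right cinner_self[of x] del: of_real_power)
  also have "\<dots> = of_real ((cmod a * norm x)\<^sup>2)"
    by (simp only: power_mult_distrib of_real_mult complex_norm_square)
  finally have "cinner (scaleC a x) (scaleC a x) = of_real ((cmod a * norm x)\<^sup>2)" .
  then have "complex_of_real ((norm (scaleC a x))\<^sup>2) = complex_of_real ((cmod a * norm x)\<^sup>2)"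
    by (simp only: cinner_self)
  then have "(norm (scaleC a x))\<^sup>2 = (cmod a * norm x)\<^sup>2"
    by (rule of_real_eq_iff[THEN iffD1])
  then show ?thesis by (simp add: power2_eq_iff_nonneg)
qed

lemma cauchy_schwarz: "cmod (cinner x (y::'a::complex_inner)) \<le> norm x * norm y"
proof -
  have re: "Re (cinner x y) \<le> norm x * norm y" for x y :: 'a
  proof -
    have "(norm (x + y))\<^sup>2 \<le> (norm x + norm y)\<^sup>2"
      by (intro power_mono norm_triangle_ineq) simp
    then show ?thesis unfolding cinner_Re power2_sum by simp
  qed
  \<comment> \<open>Rotating \<open>x\<close> by the phase \<open>a\<close> makes the inner product real and non-negative.\<close>
  define a where "a = cnj (sgn (cinner x y))"
  have "cmod a \<le> 1" by (simp add: a_def norm_sgn)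
  have "a * cinner x y = cmod (cinner x y)"
  proof (cases "cinner x y = 0")
    case False
    then show ?thesis
      by (simp add: a_def sgn_eq mult.commute complex_norm_square[symmetric] power2_eq_square)
  qed simp
  then have "cmod (cinner x y) = Re (cinner (scaleC a x) y)"
    by (simp add: cinner_scaleC_left)
  also have "\<dots> \<le> cmod a * norm x * norm y"
    using re[of "scaleC a x" y] by (simp add: norm_scaleC)
  also have "\<dots> \<le> 1 * norm x * norm y"
    using \<open>cmod a \<le> 1\<close> by (intro mult_right_mono) auto
  finally show ?thesis by simp
qed

lemma cinner_eqI:
  assumes "\<And>z. cinner z x = cinner z (y::'a::complex_inner)"
  shows "x = y"
proof -
  have "cinner (x - y) (x - y) = 0" using assms[of "x - y"] by (simp add: cinner_diff_right)
  then show ?thesis by (simp add: cinner_self)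
qed

lemma bounded_linear_scaleC: "bounded_linear (scaleC a :: 'a::complex_inner \<Rightarrow> 'a)"
  by (rule bounded_linear_intro[of _ "cmod a"])
    (simp_all add: scaleC_add_right scaleC_scaleC mult.commute norm_scaleC flip: scaleC_of_real)

lemma bounded_opI:
  assumes "\<And>x y. A (x + y) = A x + A y" "\<And>c x. A (scaleC c x) = scaleC c (A x)"
    "\<And>x. norm (A x) \<le> norm x * K"
  shows "A \<in> bounded_op"
  unfolding bounded_op_def
  by (simp add: assms bounded_linear_intro[of A K, OF assms(1) _ assms(3)] flip: scaleC_of_real)

lemma bounded_op_add: "A \<in> bounded_op \<Longrightarrow> A (x + y) = A x + A y"
  by (simp add: bounded_op_def bounded_linear.linear linear_add)

lemma bounded_op_scaleC: "A \<in> bounded_op \<Longrightarrow> A (scaleC c x) = scaleC c (A x)"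
  by (simp add: bounded_op_def)

lemma bounded_op_linear: "A \<in> bounded_op \<Longrightarrow> bounded_linear A"
  by (simp add: bounded_op_def)

lemma isometry_cinner:
  assumes "isometry_op U"
  shows "cinner (U x) (U y) = cinner x y"
proof -
  have U: "U \<in> bounded_op" and n: "norm (U x) = norm x" for x
    using assms by (auto simp: isometry_op_def)
  have Re: "Re (cinner (U x) (U y)) = Re (cinner x y)" for x y
    by (simp add: cinner_Re n flip: bounded_op_add[OF U])
  show ?thesis
    by (rule complex_eqI) (simp_all add: Re Im_cinner flip: bounded_op_scaleC[OF U])
qed

subsection \<open>Riesz representation and adjoints\<close>

text \<open>The representing vector of \<open>l\<close> is the minimiser of \<open>\<parallel>x\<parallel>\<^sup>2 - 2 Re (l x)\<close>: by the parallelogram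
  law every minimising sequence is Cauchy, and the first variation at the minimum is the claim.\<close>

lemma riesz_representation:
  fixes l :: "'h::chilbert_space \<Rightarrow> complex"
  assumes add: "\<And>x y. l (x + y) = l x + l y" and scale: "\<And>c x. l (scaleC c x) = c * l x"
    and bound: "\<And>x. cmod (l x) \<le> K * norm x"
  shows "\<exists>y. \<forall>x. l x = cinner x y"
proof -
  define J where "J x = (norm x)\<^sup>2 - 2 * Re (l x)" for x
  have scaleR: "l (r *\<^sub>R x) = of_real r * l x" for r x
    by (metis scale scaleC_of_real)
  have lin: "bounded_linear l"
    by (rule bounded_linear_intro[of _ K]) (auto simp: add scaleR scaleR_conv_of_real bound mult.commute)
  have lower: "J x \<ge> - K\<^sup>2" for x
  proof -
    have "Re (l x) \<le> K * norm x" using bound[of x] complex_Re_le_cmod[of "l x"] by linarith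
    moreover have "0 \<le> (norm x - K)\<^sup>2" by simp
    ultimately show ?thesis by (simp add: J_def power2_diff mult.commute)
  qed
  define m where "m = Inf (range J)"
  have m_le: "m \<le> J x" for x
    unfolding m_def by (rule cInf_lower) (auto intro!: bdd_belowI[of _ "- K\<^sup>2"] lower)
  have "\<exists>x. J x < m + inverse (Suc n)" for n
    using cInf_lessD[of "range J" "m + inverse (Suc n)"] unfolding m_def by auto
  then obtain u where u: "\<And>n. J (u n) < m + inverse (Suc n)" by metis
  have par: "(norm (x - y))\<^sup>2 = 2 * J x + 2 * J y - 4 * J ((1/2) *\<^sub>R (x + y))" for x y
  proof -
    have "J ((1/2) *\<^sub>R (x + y)) = (norm (x + y))\<^sup>2 / 4 - Re (l x) - Re (l y)"
      by (simp add: J_def scaleR add power_divide add_divide_distrib)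
    moreover have "J x = (norm x)\<^sup>2 - 2 * Re (l x)" "J y = (norm y)\<^sup>2 - 2 * Re (l y)"
      by (simp_all add: J_def)
    ultimately show ?thesis
      using norm_add_sq[of x y] norm_diff_sq[of x y] by argo
  qed
  have close: "(norm (u i - u j))\<^sup>2 \<le> 2 * inverse (Suc i) + 2 * inverse (Suc j)" for i j
    using par[of "u i" "u j"] u[of i] u[of j] m_le[of "(1/2) *\<^sub>R (u i + u j)"] by linarith
  have "Cauchy u"
    unfolding Cauchy_iff
  proof (intro allI impI)
    fix e :: real assume "e > 0"
    then obtain N where N: "inverse (Suc N) < e\<^sup>2 / 4"
      using reals_Archimedean[of "e\<^sup>2/4"] by auto
    have "norm (u i - u j) < e" if "i \<ge> N" "j \<ge> N" for i j
    proof -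
      have "inverse (real (Suc i)) \<le> inverse (Suc N)" "inverse (real (Suc j)) \<le> inverse (Suc N)"
        using that by (auto intro!: le_imp_inverse_le)
      then have "(norm (u i - u j))\<^sup>2 < e\<^sup>2" using close[of i j] N by linarith
      then show ?thesis using \<open>e > 0\<close> power_less_imp_less_base by fastforce
    qed
    then show "\<exists>M. \<forall>i\<ge>M. \<forall>j\<ge>M. norm (u i - u j) < e" by blast
  qed
  then obtain y where y: "u \<longlonglongrightarrow> y" using Cauchy_convergent convergent_def by blast
  have "(\<lambda>n. J (u n)) \<longlonglongrightarrow> J y"
    unfolding J_def by (intro tendsto_intros y bounded_linear.tendsto[OF lin])
  moreover have "(\<lambda>n. m + inverse (real (Suc n))) \<longlonglongrightarrow> m + 0"
    by (intro tendsto_intros LIMSEQ_inverse_real_of_nat)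
  ultimately have "J y \<le> m + 0"
    by (rule LIMSEQ_le) (use u less_imp_le in blast)
  then have min: "J y \<le> J x" for x using m_le[of x] by linarith
  have re: "Re (l x) = Re (cinner x y)" for x
  proof (rule ccontr)
    define d where "d = Re (l x) - Re (cinner x y)"
    assume "Re (l x) \<noteq> Re (cinner x y)"
    then have "d \<noteq> 0" by (simp add: d_def)
    \<comment> \<open>A step of this size along \<open>x\<close> would lower \<open>J\<close>; the summand 1 covers \<open>x = 0\<close>.\<close>
    define r where "r = d / ((norm x)\<^sup>2 + 1)"
    have "J (y + r *\<^sub>R x) = J y + r\<^sup>2 * (norm x)\<^sup>2 - 2 * r * d"
      by (simp add: J_def norm_add_sq add scaleR cinner_scaleR_right cinner_commute[of y x] d_def
          power_mult_distrib algebra_simps)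
    then have *: "2 * r * d \<le> r\<^sup>2 * (norm x)\<^sup>2" using min[of "y + r *\<^sub>R x"] by simp
    have pos: "(norm x)\<^sup>2 + 1 > 0" by (simp add: add_nonneg_pos)
    have d: "d = r * ((norm x)\<^sup>2 + 1)" using pos by (simp add: r_def)
    then have "r \<noteq> 0" using \<open>d \<noteq> 0\<close> by auto
    have "2 * r * d = 2 * r\<^sup>2 * (norm x)\<^sup>2 + 2 * r\<^sup>2" unfolding d by (simp add: power2_eq_square algebra_simps)
    moreover have "r\<^sup>2 > 0" "r\<^sup>2 * (norm x)\<^sup>2 \<ge> 0" using \<open>r \<noteq> 0\<close> by auto
    ultimately show False using * by linarith
  qed
  have "Im (l x) = Im (cinner x y)" for x
    using re[of "scaleC \<i> x"] by (simp add: scale cinner_scaleC_left)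
  then have "l x = cinner x y" for x using re[of x] complex_eqI by blast
  then show ?thesis by blast
qed

text \<open>Adjoints are unique, so exhibiting one evaluates the definite description.\<close>

lemma cadjoint_eqI:
  assumes "B \<in> bounded_op" "\<And>x y. cinner (A x) y = cinner x (B y)"
  shows "cadjoint A = B"
  unfolding cadjoint_def
proof (rule the_equality)
  fix C assume C: "C \<in> bounded_op \<and> (\<forall>x y. cinner (A x) y = cinner x (C y))"
  show "C = B"
  proof
    fix y show "C y = B y"
      by (rule cinner_eqI) (use C assms(2) in metis)
  qed
qed (use assms in auto)

lemma cadjoint:
  fixes A :: "'a::chilbert_space \<Rightarrow> 'b::complex_inner"
  assumes A: "A \<in> bounded_op"
  shows "cadjoint A \<in> bounded_op" and "cinner (A x) y = cinner x (cadjoint A y)"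
proof -
  obtain K where "K > 0" and K: "\<And>x. norm (A x) \<le> norm x * K"
    using bounded_linear.pos_bounded[OF bounded_op_linear[OF A]] by auto
  have "\<exists>z. \<forall>x. cinner (A x) y = cinner x z" for y
  proof (rule riesz_representation[where K = "K * norm y"])
    fix x
    have "cmod (cinner (A x) y) \<le> norm (A x) * norm y" by (rule cauchy_schwarz)
    also have "\<dots> \<le> norm x * K * norm y" by (intro mult_right_mono K) simp
    finally show "cmod (cinner (A x) y) \<le> K * norm y * norm x" by (simp add: mult_ac)
  qed (simp_all add: bounded_op_add[OF A] bounded_op_scaleC[OF A] cinner_add_left cinner_scaleC_left)
  then obtain B where B: "\<And>x y. cinner (A x) y = cinner x (B y)" by metis
  have "norm (B y) \<le> norm y * K" for y
  proof (cases "B y = 0")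
    case False
    have "(norm (B y))\<^sup>2 = Re (cinner (A (B y)) y)" by (simp add: B norm_sq_cinner)
    also have "\<dots> \<le> norm (A (B y)) * norm y"
      using cauchy_schwarz complex_Re_le_cmod order_trans by blast
    also have "\<dots> \<le> norm (B y) * K * norm y" by (intro mult_right_mono K) simp
    finally show ?thesis using False by (simp add: power2_eq_square mult_ac)
  qed (use \<open>K > 0\<close> in simp)
  moreover have "B (x + y) = B x + B y" for x y
    by (rule cinner_eqI) (simp add: cinner_add_right flip: B)
  moreover have "B (scaleC c x) = scaleC c (B x)" for c x
    by (rule cinner_eqI) (simp add: cinner_scaleC_right flip: B)
  ultimately have "B \<in> bounded_op" by (intro bounded_opI)
  with B have "cadjoint A = B" by (intro cadjoint_eqI)
  then show "cadjoint A \<in> bounded_op" "cinner (A x) y = cinner x (cadjoint A y)"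
    using \<open>B \<in> bounded_op\<close> B by simp_all
qed

subsection \<open>Total sets\<close>

definition total_set :: "'a::complex_inner set \<Rightarrow> bool" where
  "total_set S \<longleftrightarrow> closure (complex_vector.span S) = UNIV"

lemma closed_csubspace_total:
  assumes "total_set S" "S \<subseteq> M" "complex_vector.subspace M" "closed M"
  shows "M = UNIV"
proof -
  have "closure (complex_vector.span S) \<subseteq> M"
    by (intro closure_minimal complex_vector.span_minimal assms)
  then show ?thesis using assms(1) by (auto simp: total_set_def)
qed

lemma bounded_op_eqI:
  assumes "total_set S" "A \<in> bounded_op" "B \<in> bounded_op" "\<And>x. x \<in> S \<Longrightarrow> A x = B x"
  shows "A = (B :: 'a::complex_inner \<Rightarrow> 'b::complex_inner)"
proof -
  have "{x. A x = B x} = UNIV"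
  proof (rule closed_csubspace_total[OF assms(1)])
    show "complex_vector.subspace {x. A x = B x}"
      using bounded_op_scaleC[OF assms(2), of 0 0] bounded_op_scaleC[OF assms(3), of 0 0]
      by (auto simp: complex_vector.subspace_def bounded_op_add assms(2,3) bounded_op_scaleC)
    show "closed {x. A x = B x}"
      by (intro closed_Collect_eq linear_continuous_on bounded_op_linear assms)
  qed (use assms in auto)
  then show ?thesis by (intro ext) blast
qed

lemma continuous_on_cinner:
  assumes "continuous_on S f" "continuous_on S g"
  shows "continuous_on S (\<lambda>x. cinner (f x) (g x :: 'a::complex_inner))"
  using assms unfolding continuous_on_def by (auto intro!: tendsto_cinner)

lemma total_cinner_eqI:
  assumes "total_set S" "\<And>z. z \<in> S \<Longrightarrow> cinner z x = cinner z (y::'a::complex_inner)"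
  shows "x = y"
proof -
  have "{z. cinner z x = cinner z y} = UNIV"
    by (rule closed_csubspace_total[OF assms(1)])
      (auto simp: assms(2) complex_vector.subspace_def cinner_add_left cinner_scaleC_left
        intro!: closed_Collect_eq continuous_on_cinner continuous_intros)
  then show ?thesis by (intro cinner_eqI) blast
qed

lemma subspace_closure:
  assumes "complex_vector.subspace (M::'a::complex_inner set)"
  shows "complex_vector.subspace (closure M)"
  unfolding complex_vector.subspace_def
proof (intro conjI allI ballI)
  show "0 \<in> closure M"
    using assms closure_subset by (auto simp: complex_vector.subspace_def)
  fix x y assume "x \<in> closure M" "y \<in> closure M"
  then obtain f g where "\<And>n. f n \<in> M" "f \<longlonglongrightarrow> x" "\<And>n. g n \<in> M" "g \<longlonglongrightarrow> y"
    unfolding closure_sequential by metis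
  then have "(\<lambda>n. f n + g n) \<longlonglongrightarrow> x + y" "\<And>n. f n + g n \<in> M"
    using assms by (auto intro!: tendsto_add simp: complex_vector.subspace_def)
  then show "x + y \<in> closure M" unfolding closure_sequential by metis
next
  fix c x assume "x \<in> closure M"
  then obtain f where "\<And>n. f n \<in> M" "f \<longlonglongrightarrow> x"
    unfolding closure_sequential by metis
  then have "(\<lambda>n. scaleC c (f n)) \<longlonglongrightarrow> scaleC c x" "\<And>n. scaleC c (f n) \<in> M"
    using assms bounded_linear.tendsto[OF bounded_linear_scaleC]
    by (auto simp: complex_vector.subspace_def)
  then show "scaleC c x \<in> closure M" unfolding closure_sequential by metis
qed

section \<open>Extension of isometries from total families\<close>

text \<open>Formal linear combinations are lists of coefficients and indices, not functions of the index with
  finite support: addition is concatenation, and the indexed vectors may be linearly dependent.\<close>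

definition lincomb :: "('i \<Rightarrow> 'a::complex_inner) \<Rightarrow> (complex \<times> 'i) list \<Rightarrow> 'a" where
  "lincomb e xs = (\<Sum>(c, i)\<leftarrow>xs. scaleC c (e i))"

lemma lincomb_simps [simp]:
  "lincomb e [] = 0"
  "lincomb e ((c, i) # xs) = scaleC c (e i) + lincomb e xs"
  "lincomb e (xs @ ys) = lincomb e xs + lincomb e ys"
  by (simp_all add: lincomb_def)

lemma lincomb_scale: "lincomb e (map (apfst ((*) c)) xs) = scaleC c (lincomb e xs)"
  by (induction xs) (auto simp: scaleC_add_right scaleC_scaleC)

lemma span_lincomb: "complex_vector.span (range e) \<subseteq> range (lincomb e)"
proof (rule complex_vector.span_minimal)
  show "range e \<subseteq> range (lincomb e)"
  proof (clarify, rule range_eqI)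
    show "e i = lincomb e [(1, i)]" for i by simp
  qed
  show "complex_vector.subspace (range (lincomb e))"
    unfolding complex_vector.subspace_def
  proof (intro conjI allI ballI)
    show "0 \<in> range (lincomb e)" by (rule range_eqI[of _ _ "[]"]) simp
    show "x + y \<in> range (lincomb e)"
      if "x \<in> range (lincomb e)" "y \<in> range (lincomb e)" for x y
    proof -
      from that obtain xs ys where "x = lincomb e xs" "y = lincomb e ys" by blast
      then have "x + y = lincomb e (xs @ ys)" by simp
      then show ?thesis by blast
    qed
    show "scaleC c x \<in> range (lincomb e)" if "x \<in> range (lincomb e)" for c x
    proof -
      from that obtain xs where "x = lincomb e xs" by blast
      then have "scaleC c x = lincomb e (map (apfst ((*) c)) xs)" by (simp add: lincomb_scale)
      then show ?thesis by blast
    qed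
  qed
qed

lemma cinner_lincomb:
  assumes "\<And>i j. cinner (e i) (e j) = cinner (e' i) (e' j)"
  shows "cinner (lincomb e xs) (lincomb e ys) = cinner (lincomb e' xs) (lincomb e' ys)"
proof -
  have "cinner (e i) (lincomb e ys) = cinner (e' i) (lincomb e' ys)" for i
    by (induction ys) (auto simp: cinner_add_right cinner_scaleC_right assms)
  then show ?thesis
    by (induction xs) (auto simp: cinner_add_left cinner_scaleC_left)
qed

text \<open>The distance between two linear combinations is a function of the Gram matrix, so replacing \<open>e\<close> by
  \<open>e'\<close> in a linear combination is a well defined isometry on a dense subspace. It is uniformly
  continuous and extends to the closure, where linearity survives by taking limits.\<close>

lemma isometric_extension:
  fixes e :: "'i \<Rightarrow> 'a::complex_inner" and e' :: "'i \<Rightarrow> 'b::chilbert_space"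
  assumes gram: "\<And>i j. cinner (e i) (e j) = cinner (e' i) (e' j)" and total: "total_set (range e)"
  obtains U where "isometry_op U" "\<And>i. U (e i) = e' i"
proof -
  let ?S = "range (lincomb e)"
  have dense: "closure ?S = UNIV"
    using closure_mono[OF span_lincomb[of e]] total by (auto simp: total_set_def)
  define f where "f x = lincomb e' (inv (lincomb e) x)" for x
  have "norm (lincomb e xs - lincomb e ys) = norm (lincomb e' xs - lincomb e' ys)" for xs ys
  proof -
    have "(norm (lincomb e xs - lincomb e ys))\<^sup>2 = (norm (lincomb e' xs - lincomb e' ys))\<^sup>2"
      by (simp add: norm_sq_cinner cinner_diff_left cinner_diff_right
          cinner_lincomb[OF gram])
    then show ?thesis by (simp add: power2_eq_iff_nonneg)
  qed
  note dist = this
  have f: "f (lincomb e xs) = lincomb e' xs" for xs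
  proof -
    have "lincomb e (inv (lincomb e) (lincomb e xs)) = lincomb e xs" by (simp add: f_inv_into_f)
    then show ?thesis using dist[of "inv (lincomb e) (lincomb e xs)" xs] by (simp add: f_def)
  qed
  have "uniformly_continuous_on ?S f"
    unfolding uniformly_continuous_on_def dist_norm
    by (auto simp: f simp flip: dist)
  then obtain U where U: "uniformly_continuous_on (closure ?S) U" "\<And>x. x \<in> ?S \<Longrightarrow> f x = U x"
    using uniformly_continuous_on_extension_on_closure by metis
  have U_comb: "U (lincomb e xs) = lincomb e' xs" for xs
    using U(2)[of "lincomb e xs"] by (simp add: f)
  have cont: "continuous_on UNIV U"
    using uniformly_continuous_imp_continuous[OF U(1)] dense by simp
  have lim: "(\<lambda>n. U (g n)) \<longlonglongrightarrow> U x" if "g \<longlonglongrightarrow> x" for g x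
    using continuous_on_tendsto_compose[OF cont that] by simp
  have approx: "\<exists>xs. (\<lambda>n. lincomb e (xs n)) \<longlonglongrightarrow> x" for x
  proof -
    have "x \<in> closure ?S" using dense by simp
    then obtain g where "\<And>n. g n \<in> ?S" "g \<longlonglongrightarrow> x" unfolding closure_sequential by metis
    moreover from this(1) have "\<exists>ys. g n = lincomb e ys" for n by blast
    then obtain xs where "\<And>n. g n = lincomb e (xs n)" by metis
    then have "g = (\<lambda>n. lincomb e (xs n))" by blast
    ultimately show ?thesis by blast
  qed
  have add: "U (x + y) = U x + U y" for x y
  proof -
    obtain xs ys where xs: "(\<lambda>n. lincomb e (xs n)) \<longlonglongrightarrow> x" and ys: "(\<lambda>n. lincomb e (ys n)) \<longlonglongrightarrow> y"
      using approx by metis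
    have "(\<lambda>n. U (lincomb e (xs n @ ys n))) \<longlonglongrightarrow> U (x + y)"
      using lim[OF tendsto_add[OF xs ys]] by simp
    moreover have "(\<lambda>n. U (lincomb e (xs n @ ys n))) \<longlonglongrightarrow> U x + U y"
      using tendsto_add[OF lim[OF xs] lim[OF ys]] by (simp add: U_comb del: lincomb_simps) (simp add: U_comb)
    ultimately show ?thesis by (rule LIMSEQ_unique)
  qed
  have scale: "U (scaleC c x) = scaleC c (U x)" for c x
  proof -
    obtain xs where xs: "(\<lambda>n. lincomb e (xs n)) \<longlonglongrightarrow> x" using approx by metis
    have "(\<lambda>n. U (lincomb e (map (apfst ((*) c)) (xs n)))) \<longlonglongrightarrow> U (scaleC c x)"
      unfolding lincomb_scale by (rule lim[OF bounded_linear.tendsto[OF bounded_linear_scaleC xs]])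
    moreover have "(\<lambda>n. U (lincomb e (map (apfst ((*) c)) (xs n)))) \<longlonglongrightarrow> scaleC c (U x)"
      using bounded_linear.tendsto[OF bounded_linear_scaleC lim[OF xs], of c]
      by (simp only: U_comb lincomb_scale[of e'])
    ultimately show ?thesis by (rule LIMSEQ_unique)
  qed
  have norm: "norm (U x) = norm x" for x
  proof -
    obtain xs where xs: "(\<lambda>n. lincomb e (xs n)) \<longlonglongrightarrow> x" using approx by metis
    have "norm (U (lincomb e (xs n))) = norm (lincomb e (xs n))" for n
      using dist[of "xs n" "[]"] by (simp add: U_comb)
    then show ?thesis
      using LIMSEQ_unique[OF tendsto_norm[OF lim[OF xs]]] tendsto_norm[OF xs] by simp
  qed
  have "isometry_op U"
    using bounded_opI[of U 1] add scale norm by (simp add: isometry_op_def)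
  moreover have "U (e i) = e' i" for i
    using U_comb[of "[(1, i)]"] by simp
  ultimately show ?thesis by (rule that)
qed

lemma isometry_closed_range:
  fixes U :: "'a::chilbert_space \<Rightarrow> 'b::complex_inner"
  assumes "isometry_op U"
  shows "closed (range U)"
proof -
  have U: "U \<in> bounded_op" and n: "norm (U x) = norm x" for x
    using assms by (auto simp: isometry_op_def)
  have "complete (range U)"
    by (rule complete_isometric_image[of 1])
      (auto simp: n bounded_op_linear[OF U] complete_UNIV subspace_UNIV)
  then show ?thesis by (rule complete_imp_closed)
qed

lemma unitary_op_iff:
  fixes U :: "'a::chilbert_space \<Rightarrow> 'a"
  shows "unitary_op U \<longleftrightarrow> isometry_op U \<and> surj U"
proof
  assume U: "unitary_op U"
  then have b: "U \<in> bounded_op" and inv: "\<And>x. cadjoint U (U x) = x" "\<And>x. U (cadjoint U x) = x"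
    by (auto simp: unitary_op_def fun_eq_iff)
  have "(norm (U x))\<^sup>2 = (norm x)\<^sup>2" for x
    by (simp add: norm_sq_cinner cadjoint(2)[OF b] inv)
  then have "norm (U x) = norm x" for x by (simp add: power2_eq_iff_nonneg)
  then show "isometry_op U \<and> surj U" using b inv(2) by (auto simp: isometry_op_def intro!: surjI)
next
  assume U: "isometry_op U \<and> surj U"
  then have b: "U \<in> bounded_op" by (simp add: isometry_op_def)
  have left: "cadjoint U (U x) = x" for x
    by (rule cinner_eqI) (metis U cadjoint(2)[OF b] isometry_cinner)
  have "U (cadjoint U y) = y" for y
    using left U by (metis surjD)
  then show "unitary_op U" using left b by (auto simp: unitary_op_def)
qed

section \<open>Exponential vectors\<close>

text \<open>Ryser's formula for the permanent: expanding the product for \<open>S\<close> gives a sum over all maps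
  \<open>f : A \<rightarrow> S\<close>, which is the sum over \<open>T \<subseteq> S\<close> of the contributions \<open>h T\<close> of the maps with image \<open>T\<close>.
  Inclusion-exclusion recovers \<open>h A\<close>, and the surjective maps \<open>A \<rightarrow> A\<close> are the permutations.\<close>

lemma permanent_ryser:
  fixes a :: "'i \<Rightarrow> 'i \<Rightarrow> 'b::comm_ring_1"
  assumes A: "finite A"
  shows "(\<Sum>\<sigma> | \<sigma> permutes A. \<Prod>j\<in>A. a (\<sigma> j) j) =
     (\<Sum>S\<in>Pow A. (-1) ^ card A * (-1) ^ card S * (\<Prod>j\<in>A. \<Sum>i\<in>S. a i j))"
proof -
  \<comment> \<open>Extensional maps make the correspondence with permutations of \<open>A\<close> one-to-one.\<close>
  define h where "h T = (\<Sum>f | f \<in> A \<rightarrow>\<^sub>E T \<and> f ` A = T. \<Prod>j\<in>A. a (f j) j)" for T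
  define g where "g S = (\<Prod>j\<in>A. \<Sum>i\<in>S. a i j)" for S
  have "g S = (\<Sum>T\<in>Pow S. (-1) ^ card T * ((-1) ^ card T * h T))" if S: "finite S" for S
  proof -
    have "g S = (\<Sum>f\<in>A \<rightarrow>\<^sub>E S. \<Prod>j\<in>A. a (f j) j)"
      unfolding g_def by (rule prod_sum_PiE[OF A]) (rule S)
    also have "\<dots> = (\<Sum>T\<in>Pow S. \<Sum>f | f \<in> A \<rightarrow>\<^sub>E S \<and> f ` A = T. \<Prod>j\<in>A. a (f j) j)"
      by (rule sum.group[symmetric]) (use A S in \<open>auto intro: finite_PiE\<close>)
    also have "\<dots> = (\<Sum>T\<in>Pow S. h T)"
      unfolding h_def by (intro sum.cong refl Collect_cong) (auto simp: PiE_iff)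
    finally show ?thesis by (simp flip: mult.assoc power_add)
  qed
  then have "(-1) ^ card A * h A = (\<Sum>T\<in>Pow A. (-1) ^ card T * g T)"
    by (rule inclusion_exclusion_symmetric) (use A in simp_all)
  then have "(-1) ^ card A * ((-1) ^ card A * h A) = (\<Sum>T\<in>Pow A. (-1) ^ card A * (-1) ^ card T * g T)"
    by (simp add: sum_distrib_left mult.assoc)
  then have "h A = (\<Sum>T\<in>Pow A. (-1) ^ card A * (-1) ^ card T * g T)"
    by (simp flip: mult.assoc power_add)
  moreover have "(\<Sum>\<sigma> | \<sigma> permutes A. \<Prod>j\<in>A. a (\<sigma> j) j) = h A"
    unfolding h_def
  proof (rule sum.reindex_bij_witness[where i = "\<lambda>f j. if j \<in> A then f j else j" and j = "\<lambda>\<sigma>. restrict \<sigma> A"])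
    fix f assume f: "f \<in> {f \<in> A \<rightarrow>\<^sub>E A. f ` A = A}"
    then have "bij_betw f A A" using A by (auto simp: bij_betw_def finite_surj_inj)
    then have "bij_betw (\<lambda>j. if j \<in> A then f j else j) A A"
      by (subst bij_betw_cong[where g = f]) auto
    then show "(\<lambda>j. if j \<in> A then f j else j) \<in> {\<sigma>. \<sigma> permutes A}"
      by (auto intro: bij_imp_permutes)
  qed (auto simp: permutes_image permutes_in_image permutes_not_in fun_eq_iff PiE_iff extensional_def)
  ultimately show ?thesis by (simp add: g_def)
qed

context
  fixes \<Phi> :: "'h::complex_inner list \<Rightarrow> 'f::chilbert_space"
  assumes fock: "symmetric_fock_space \<Phi>"
begin

lemma fock_total: "total_set (range \<Phi>)"
  using fock by (simp add: symmetric_fock_space_def total_set_def)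

lemma cinner_fock:
  "cinner (\<Phi> xs) (\<Phi> ys) =
     (if length xs = length ys
      then (\<Sum>\<sigma> | \<sigma> permutes {..<length xs}. \<Prod>i<length xs. cinner (xs ! i) (ys ! \<sigma> i)) / fact (length xs)
      else 0)"
  using fock unfolding symmetric_fock_space_def by blast

text \<open>Against a pure power all permutations contribute equally, which cancels the factorial.\<close>

lemma cinner_fock_power:
  "cinner (\<Phi> ys) (\<Phi> (replicate n \<eta>)) =
     (if length ys = n then \<Prod>i<n. cinner (ys ! i) \<eta> else 0)"
proof -
  have "(\<Prod>i<n. cinner (ys ! i) (replicate n \<eta> ! \<sigma> i)) = (\<Prod>i<n. cinner (ys ! i) \<eta>)"
    if "\<sigma> permutes {..<n}" for \<sigma>
    using permutes_in_image[OF that] by (intro prod.cong) auto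
  then show ?thesis
    by (simp add: cinner_fock card_permutations[of "{..<n}" n])
qed

lemma fock_eqI:
  assumes "\<And>ys. cinner (\<Phi> ys) x = cinner (\<Phi> ys) y"
  shows "x = y"
  by (rule total_cinner_eqI[OF fock_total]) (use assms in auto)

lemma fock_power_scaleC: "\<Phi> (replicate n (scaleC c \<eta>)) = scaleC (c ^ n) (\<Phi> (replicate n \<eta>))"
  by (rule fock_eqI) (simp add: cinner_fock_power cinner_scaleC_right prod.distrib)

text \<open>Pairing both sides with \<open>\<Phi> ys\<close> turns this into Ryser's formula for the matrix of inner products of
  the entries of \<open>ys\<close> and \<open>xs\<close>.\<close>

lemma fock_polarization:
  "scaleC (fact (length xs)) (\<Phi> xs) =
     (\<Sum>S\<in>Pow {..<length xs}. scaleC ((-1) ^ length xs * (-1) ^ card S)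
        (\<Phi> (replicate (length xs) (\<Sum>i\<in>S. xs ! i))))"
proof (rule fock_eqI)
  fix ys :: "'h list"
  show "cinner (\<Phi> ys) (scaleC (fact (length xs)) (\<Phi> xs)) = cinner (\<Phi> ys)
     (\<Sum>S\<in>Pow {..<length xs}. scaleC ((-1) ^ length xs * (-1) ^ card S)
        (\<Phi> (replicate (length xs) (\<Sum>i\<in>S. xs ! i))))"
    (is "?l = cinner _ ?p")
  proof -
    have "?l = (if length ys = length xs
        then \<Sum>\<sigma> | \<sigma> permutes {..<length xs}. \<Prod>j<length xs. cinner (ys ! j) (xs ! \<sigma> j) else 0)"
      by (simp add: cinner_scaleC_right cinner_fock)
    also have "\<dots> = cinner (\<Phi> ys) ?p"
      using permanent_ryser[of "{..<length xs}" "\<lambda>i j. cinner (ys ! j) (xs ! i)"]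
      by (simp add: cinner_scaleC_right cinner_sum_right cinner_fock_power)
    finally show ?thesis .
  qed
qed

text \<open>The power \<open>\<eta>\<^sup>n\<close> is, up to a scalar, the \<open>n\<close>-th Taylor coefficient at 0 of \<open>r \<mapsto> e(r \<eta>)\<close>. Once
  the lower coefficients are known to lie in \<open>M\<close>, it is the limit of \<open>(e(r \<eta>) - \<Sum>\<^sub>k\<^sub><\<^sub>n r\<^sup>k v\<^sub>k) / r\<^sup>n\<close> as
  \<open>r \<rightarrow> 0\<close>.\<close>

lemma closed_subspace_fock_power:
  assumes M: "complex_vector.subspace M" "closed M" and e: "range (expvec \<Phi>) \<subseteq> M"
  shows "\<Phi> (replicate n \<eta>) \<in> M"
proof -
  define v where "v k = (1 / sqrt (fact k)) *\<^sub>R \<Phi> (replicate k \<eta>)" for k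
  have scaleR_M: "r *\<^sub>R x \<in> M" if "x \<in> M" for x r
    using M(1) that by (metis complex_vector.subspace_scale scaleC_of_real)
  have sums: "(\<lambda>k. r ^ k *\<^sub>R v k) sums expvec \<Phi> (r *\<^sub>R \<eta>)" for r
    using expvec_sums[OF fock, of "r *\<^sub>R \<eta>"] fock_power_scaleC[of _ "of_real r" \<eta>]
    by (simp add: v_def scaleC_of_real mult.commute flip: of_real_power)
  \<comment> \<open>The series converges at \<open>r = 2\<close>, so its terms there are bounded and those at \<open>r = 1\<close> decay geometrically.\<close>
  have summ: "summable (\<lambda>k. norm (v k))"
  proof -
    have "Bseq (\<lambda>k. 2 ^ k *\<^sub>R v k)"
      using sums[of 2] summable_LIMSEQ_zero sums_summable convergentI convergent_imp_Bseq by blast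
    then obtain B where B: "\<And>k. norm (2 ^ k *\<^sub>R v k) \<le> B" by (auto simp: Bseq_def)
    have le: "norm (norm (v k)) \<le> B * (1/2) ^ k" for k
      using B[of k] by (simp add: field_simps)
    have "summable (\<lambda>k. B * (1/2::real) ^ k)"
      by (intro summable_mult summable_geometric) simp
    then show ?thesis by (rule summable_comparison_test') (rule le)
  qed
  have "v n \<in> M" for n
  proof (induction n rule: less_induct)
    case (less n)
    define C where "C = (\<Sum>k. norm (v (k + Suc n)))"
    define w where "w r = (1 / r ^ n) *\<^sub>R (expvec \<Phi> (r *\<^sub>R \<eta>) - (\<Sum>k<n. r ^ k *\<^sub>R v k))" for r
    have w: "w r \<in> M" for r
      unfolding w_def
      by (intro scaleR_M complex_vector.subspace_diff[OF M(1)] complex_vector.subspace_sum[OF M(1)] less)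
        (use e in auto)
    have close: "norm (w r - v n) \<le> r * C" if r: "0 < r" "r \<le> 1" for r
    proof -
      have s: "(\<lambda>k. r ^ (k + Suc n) *\<^sub>R v (k + Suc n)) sums
          (expvec \<Phi> (r *\<^sub>R \<eta>) - (\<Sum>k<Suc n. r ^ k *\<^sub>R v k))"
        using sums by (rule sums_split_initial_segment)
      have le: "norm (r ^ (k + Suc n) *\<^sub>R v (k + Suc n)) \<le> r ^ Suc n * norm (v (k + Suc n))" for k
        using r by (auto intro!: mult_right_mono power_decreasing)
      have summ': "summable (\<lambda>k. r ^ Suc n * norm (v (k + Suc n)))"
        by (intro summable_mult summable_ignore_initial_segment summ)
      have "w r - v n = (1 / r ^ n) *\<^sub>R (expvec \<Phi> (r *\<^sub>R \<eta>) - (\<Sum>k<Suc n. r ^ k *\<^sub>R v k))"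
        using r by (simp add: w_def algebra_simps)
      also have "norm \<dots> = norm (\<Sum>k. r ^ (k + Suc n) *\<^sub>R v (k + Suc n)) / r ^ n"
        by (subst sums_unique[OF s]) (use r in simp)
      also have "\<dots> \<le> (\<Sum>k. r ^ Suc n * norm (v (k + Suc n))) / r ^ n"
        using r by (intro divide_right_mono norm_suminf_le le summ') auto
      also have "\<dots> = r * C"
        using r by (subst suminf_mult[OF summable_ignore_initial_segment[OF summ]]) (simp add: C_def)
      finally show ?thesis .
    qed
    have "(\<lambda>m. w (inverse (Suc m))) \<longlonglongrightarrow> v n"
    proof (rule LIM_zero_cancel, rule Lim_null_comparison)
      show "(\<lambda>m. inverse (real (Suc m)) * C) \<longlonglongrightarrow> 0"
        using tendsto_mult_left_zero[OF LIMSEQ_inverse_real_of_nat] .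
      show "\<forall>\<^sub>F m in sequentially. norm (w (inverse (Suc m)) - v n) \<le> inverse (Suc m) * C"
        by (intro always_eventually allI close) (auto simp: inverse_le_1_iff)
    qed
    with M(2) w show "v n \<in> M" by (rule closed_sequentially)
  qed
  then have "sqrt (fact n) *\<^sub>R v n \<in> M" by (rule scaleR_M)
  then show ?thesis by (simp add: v_def)
qed

text \<open>Limits of exponential vectors give all powers \<open>\<eta>\<^sup>n\<close>, and polarization writes every symmetrised
  elementary tensor as a combination of powers.\<close>

lemma expvec_total: "total_set (range (expvec \<Phi>))"
proof -
  let ?M = "closure (complex_vector.span (range (expvec \<Phi>)))"
  have M: "complex_vector.subspace ?M" "closed ?M" by (simp_all add: subspace_closure)
  have "range (expvec \<Phi>) \<subseteq> ?M"
    using complex_vector.span_superset closure_subset by fastforce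
  note power = closed_subspace_fock_power[OF M this]
  have "\<Phi> xs \<in> ?M" for xs
  proof -
    have "scaleC (fact (length xs)) (\<Phi> xs) \<in> ?M"
      unfolding fock_polarization
      by (intro complex_vector.subspace_sum complex_vector.subspace_scale M power)
    then have "scaleC (1 / fact (length xs)) (scaleC (fact (length xs)) (\<Phi> xs)) \<in> ?M"
      by (rule complex_vector.subspace_scale[OF M(1)])
    moreover have "scaleC (1 / fact (length xs)) (scaleC (fact (length xs)) (\<Phi> xs)) = \<Phi> xs"
      by (simp add: scaleC_scaleC)
    ultimately show ?thesis by (simp only:)
  qed
  then have "?M = UNIV" by (intro closed_csubspace_total[OF fock_total] M) auto
  then show ?thesis by (simp add: total_set_def)
qed

lemma expvec_eqI:
  assumes "\<And>\<eta>. cinner (expvec \<Phi> \<eta>) x = cinner (expvec \<Phi> \<eta>) y"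
  shows "x = y"
  by (rule total_cinner_eqI[OF expvec_total]) (use assms in auto)

lemma bounded_op_eqI_expvec:
  assumes "A \<in> bounded_op" "B \<in> bounded_op" "\<And>\<eta>. A (expvec \<Phi> \<eta>) = B (expvec \<Phi> \<eta>)"
  shows "A = (B :: 'f \<Rightarrow> 'g::complex_inner)"
  by (rule bounded_op_eqI[OF expvec_total]) (use assms in auto)

text \<open>The inner products of exponential vectors are continuous in both arguments, and they determine
  \<open>\<parallel>e(\<zeta>) - e(\<eta>)\<parallel>\<^sup>2\<close>.\<close>

lemma isCont_expvec: "isCont (expvec \<Phi>) \<eta>"
proof -
  have "((\<lambda>\<zeta>. Re (exp (cinner \<zeta> \<zeta>) - exp (cinner \<zeta> \<eta>) - exp (cinner \<eta> \<zeta>) + exp (cinner \<eta> \<eta>)))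
      \<longlongrightarrow> Re (exp (cinner \<eta> \<eta>) - exp (cinner \<eta> \<eta>) - exp (cinner \<eta> \<eta>) + exp (cinner \<eta> \<eta>))) (at \<eta>)"
    by (intro tendsto_intros tendsto_cinner)
  moreover have "Re (exp (cinner \<zeta> \<zeta>) - exp (cinner \<zeta> \<eta>) - exp (cinner \<eta> \<zeta>) + exp (cinner \<eta> \<eta>))
      = (norm (expvec \<Phi> \<zeta> - expvec \<Phi> \<eta>))\<^sup>2" for \<zeta>
    by (simp add: norm_sq_cinner cinner_diff_left cinner_diff_right cinner_expvec[OF fock])
  ultimately have "((\<lambda>\<zeta>. sqrt ((norm (expvec \<Phi> \<zeta> - expvec \<Phi> \<eta>))\<^sup>2)) \<longlongrightarrow> sqrt 0) (at \<eta>)"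
    by (intro tendsto_real_sqrt) simp
  then show ?thesis
    unfolding isCont_def by (simp add: LIM_zero_iff tendsto_norm_zero_iff)
qed

subsection \<open>Weyl operators\<close>

text \<open>The scalar factor is exactly what makes the prescribed images have the Gram matrix of the
  exponential vectors, so an isometry with these values exists; its range is closed and contains all
  exponential vectors, so it is unitary, and totality makes it unique.\<close>

lemma weyl:
  shows weyl_unitary: "unitary_op (weyl \<Phi> \<xi>)"
    and weyl_expvec: "weyl \<Phi> \<xi> (expvec \<Phi> \<eta>) =
      scaleC (exp (- of_real ((norm \<xi>)\<^sup>2 / 2) - cinner \<eta> \<xi>)) (expvec \<Phi> (\<xi> + \<eta>))"
proof -
  let ?c = "\<lambda>\<eta>. exp (- of_real ((norm \<xi>)\<^sup>2 / 2) - cinner \<eta> \<xi>)"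
  let ?e = "\<lambda>\<eta>. scaleC (?c \<eta>) (expvec \<Phi> (\<xi> + \<eta>))"
  let ?P = "\<lambda>U. unitary_op U \<and> (\<forall>\<eta>. U (expvec \<Phi> \<eta>) = ?e \<eta>)"
  have "cinner (?e \<eta>) (?e \<zeta>) = cinner (expvec \<Phi> \<eta>) (expvec \<Phi> \<zeta>)" for \<eta> \<zeta>
  proof -
    have "cnj (?c \<zeta>) = exp (- of_real ((norm \<xi>)\<^sup>2 / 2) - cinner \<xi> \<zeta>)"
      by (simp add: exp_cnj flip: cinner_commute)
    then have "cinner (?e \<eta>) (?e \<zeta>) =
        exp ((- of_real ((norm \<xi>)\<^sup>2 / 2) - cinner \<eta> \<xi>) + (- of_real ((norm \<xi>)\<^sup>2 / 2) - cinner \<xi> \<zeta>)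
          + cinner (\<xi> + \<eta>) (\<xi> + \<zeta>))"
      by (simp only: cinner_scaleC_left cinner_scaleC_right cinner_expvec[OF fock] exp_add mult_ac)
    also have "\<dots> = exp (cinner \<eta> \<zeta>)"
      by (simp add: cinner_add_left cinner_add_right cinner_self[of \<xi>])
    finally show ?thesis by (simp add: cinner_expvec[OF fock])
  qed
  then obtain U where U: "isometry_op U" "\<And>\<eta>. U (expvec \<Phi> \<eta>) = ?e \<eta>"
    using isometric_extension[of "expvec \<Phi>" ?e] expvec_total by metis
  then have bU: "U \<in> bounded_op" by (simp add: isometry_op_def)
  have "range U = UNIV"
  proof (rule closed_csubspace_total[OF expvec_total])
    show "range (expvec \<Phi>) \<subseteq> range U"
    proof (clarify, rule range_eqI)
      fix \<eta>
      show "expvec \<Phi> \<eta> = U (scaleC (inverse (?c (\<eta> - \<xi>))) (expvec \<Phi> (\<eta> - \<xi>)))"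
        by (simp add: bounded_op_scaleC[OF bU] U scaleC_scaleC)
    qed
    show "complex_vector.subspace (range U)"
    proof -
      have "U 0 = 0" using bounded_op_scaleC[OF bU, of 0 0] by simp
      then have "0 \<in> range U" by (metis rangeI)
      then show ?thesis
        unfolding complex_vector.subspace_def
        by (auto simp flip: bounded_op_add[OF bU] bounded_op_scaleC[OF bU])
    qed
    show "closed (range U)" by (rule isometry_closed_range[OF U(1)])
  qed
  then have "?P U" using U by (auto simp: unitary_op_iff)
  moreover have "W = U" if "?P W" for W
    by (rule bounded_op_eqI_expvec) (use that U bU in \<open>auto simp: unitary_op_def\<close>)
  ultimately have "?P (THE U. ?P U)" by (rule theI)
  then show "unitary_op (weyl \<Phi> \<xi>)" "weyl \<Phi> \<xi> (expvec \<Phi> \<eta>) = ?e \<eta>"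
    unfolding weyl_def by blast+
qed

end

section \<open>Intertwiners of the Weyl representation\<close>

text \<open>The derivative of \<open>cnj \<circ> f\<close> is conjugate-linear as it comes from \<open>f\<close>, and complex linear by
  assumption, so it is 0.\<close>

lemma constant_if_cnj_differentiable:
  assumes f: "\<And>z. f field_differentiable (at z)" and g: "\<And>z. (\<lambda>z. cnj (f z)) field_differentiable (at z)"
  shows "f z = f w"
proof -
  have "(f has_field_derivative 0) (at z)" for z
  proof -
    obtain D E where D: "(f has_field_derivative D) (at z)"
      and E: "((\<lambda>z. cnj (f z)) has_field_derivative E) (at z)"
      using f g unfolding field_differentiable_def by metis
    have "((\<lambda>z. cnj (f z)) has_derivative (\<lambda>h. cnj (D * h))) (at z)"
      using D unfolding has_field_derivative_def by (rule has_derivative_cnj)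
    then have "(\<lambda>h. cnj (D * h)) = (\<lambda>h. E * h)"
      using E has_derivative_unique unfolding has_field_derivative_def by blast
    from fun_cong[OF this, of 1] fun_cong[OF this, of \<i>] have "D = 0" by simp
    then show ?thesis using D by simp
  qed
  then obtain c where "\<And>z. f z = c"
    using has_field_derivative_zero_constant[of UNIV f] by auto
  then show ?thesis by simp
qed

lemma exp_affine_differentiable:
  "(\<lambda>z. exp (a + z * b)) field_differentiable (at (z::complex))"
  unfolding field_differentiable_def by (rule exI) (auto intro!: derivative_eq_intros)

text \<open>The elements of \<open>E(t)\<close> are intertwiners for \<open>S = V t\<close>. It is through this relation that the CCR
  flow enters.\<close>

definition intertwiner :: "('h::complex_inner list \<Rightarrow> 'f::chilbert_space) \<Rightarrow> ('h \<Rightarrow> 'h) \<Rightarrow> ('f \<Rightarrow> 'f) \<Rightarrow> bool" where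
  "intertwiner \<Phi> S T \<longleftrightarrow> T \<in> bounded_op \<and> (\<forall>\<xi>. weyl \<Phi> (S \<xi>) \<circ> T = T \<circ> weyl \<Phi> \<xi>)"

text \<open>The amplitude is the Bargmann transform of the vector \<open>T \<Omega>\<close>, an entire function on the one-particle
  space.\<close>

definition amplitude :: "('h::complex_inner list \<Rightarrow> 'f::chilbert_space) \<Rightarrow> ('f \<Rightarrow> 'f) \<Rightarrow> 'h \<Rightarrow> complex" where
  "amplitude \<Phi> T \<zeta> = cinner (expvec \<Phi> \<zeta>) (T (expvec \<Phi> 0))"

context
  fixes \<Phi> :: "'h::chilbert_space list \<Rightarrow> 'f::chilbert_space"
  assumes fock: "symmetric_fock_space \<Phi>"
begin

text \<open>The Fock expansion of \<open>e(z \<eta>)\<close> is a power series in \<open>z\<close> that converges everywhere.\<close>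

lemma entire_expvec:
  assumes T: "T \<in> bounded_op"
  shows "(\<lambda>z. cinner (T (expvec \<Phi> (scaleC z \<eta>))) g) field_differentiable (at z)"
proof -
  define c where "c k = cinner (T ((1 / sqrt (fact k)) *\<^sub>R \<Phi> (replicate k \<eta>))) g" for k
  have lin: "bounded_linear (\<lambda>x. cinner (T x) g)"
  proof -
    obtain K where K: "\<And>x. norm (T x) \<le> norm x * K"
      using bounded_linear.bounded[OF bounded_op_linear[OF T]] by auto
    show ?thesis
    proof (rule bounded_linear_intro[of _ "K * norm g"])
      fix x
      have "cmod (cinner (T x) g) \<le> norm (T x) * norm g" by (rule cauchy_schwarz)
      also have "\<dots> \<le> norm x * K * norm g" by (intro mult_right_mono K) simp
      finally show "cmod (cinner (T x) g) \<le> norm x * (K * norm g)" by (simp add: mult_ac)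
      show "cinner (T (r *\<^sub>R x)) g = r *\<^sub>R cinner (T x) g" for r
        by (simp add: cinner_scaleC_left bounded_op_scaleC[OF T] scaleR_conv_of_real flip: scaleC_of_real)
    qed (simp add: bounded_op_add[OF T] cinner_add_left)
  qed
  have "(\<lambda>k. c k * z ^ k) sums cinner (T (expvec \<Phi> (scaleC z \<eta>))) g" for z
  proof -
    have "cinner (T ((1 / sqrt (fact k)) *\<^sub>R \<Phi> (replicate k (scaleC z \<eta>)))) g = c k * z ^ k" for k
      by (simp add: c_def fock_power_scaleC[OF fock] cinner_scaleC_left bounded_op_scaleC[OF T] flip: scaleC_of_real)
    then show ?thesis
      using bounded_linear.sums[OF lin expvec_sums[OF fock, of "scaleC z \<eta>"]] by simp
  qed
  then have "\<And>z. summable (\<lambda>k. c k * z ^ k)"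
    and eq: "\<And>z. cinner (T (expvec \<Phi> (scaleC z \<eta>))) g = (\<Sum>k. c k * z ^ k)"
    by (auto simp: sums_iff)
  then have "((\<lambda>z. \<Sum>k. c k * z ^ k) has_field_derivative (\<Sum>k. diffs c k * z ^ k)) (at z)"
    by (intro termdiffs_strong_converges_everywhere)
  then show ?thesis by (auto simp: field_differentiable_def eq)
qed

lemma expvec_add_eq_weyl:
  "expvec \<Phi> (\<xi> + \<eta>) = scaleC (exp (of_real ((norm \<xi>)\<^sup>2 / 2) + cinner \<eta> \<xi>)) (weyl \<Phi> \<xi> (expvec \<Phi> \<eta>))"
  by (simp add: weyl_expvec[OF fock] scaleC_scaleC flip: exp_add)

lemma weyl_bounded: "weyl \<Phi> \<xi> \<in> bounded_op"
  using weyl_unitary[OF fock] by (simp add: unitary_op_def)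

text \<open>Up to scalars \<open>T e(\<eta>) = W(S \<eta>) T \<Omega>\<close> and \<open>e(\<zeta>) = W(S \<eta>) e(\<zeta> - S \<eta>)\<close>, and the unitary \<open>W(S \<eta>)\<close>
  cancels in the inner product.\<close>

lemma intertwiner_matrix:
  assumes S: "isometry_op S" and T: "intertwiner \<Phi> S T"
  shows "cinner (T (expvec \<Phi> \<eta>)) (expvec \<Phi> \<zeta>) =
    exp (cinner (S \<eta>) \<zeta>) * cnj (amplitude \<Phi> T (\<zeta> - S \<eta>))"
proof -
  let ?f = "T (expvec \<Phi> 0)" and ?n = "complex_of_real ((norm \<eta>)\<^sup>2 / 2)"
  have bT: "T \<in> bounded_op" and comm: "T (weyl \<Phi> \<eta> x) = weyl \<Phi> (S \<eta>) (T x)" for x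
    using T by (simp_all add: intertwiner_def fun_eq_iff)
  have nS: "norm (S \<eta>) = norm \<eta>" and W: "isometry_op (weyl \<Phi> (S \<eta>))"
    using S weyl_unitary[OF fock] by (simp_all add: isometry_op_def unitary_op_iff)
  have "T (expvec \<Phi> \<eta>) = scaleC (exp ?n) (weyl \<Phi> (S \<eta>) ?f)"
    using expvec_add_eq_weyl[of \<eta> 0] by (simp add: bounded_op_scaleC[OF bT] comm)
  moreover have "expvec \<Phi> \<zeta> =
      scaleC (exp (cinner \<zeta> (S \<eta>) - ?n)) (weyl \<Phi> (S \<eta>) (expvec \<Phi> (\<zeta> - S \<eta>)))"
    using expvec_add_eq_weyl[of "S \<eta>" "\<zeta> - S \<eta>"]
    by (simp add: cinner_diff_left cinner_self[of "S \<eta>"] nS)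
  ultimately have "cinner (T (expvec \<Phi> \<eta>)) (expvec \<Phi> \<zeta>) =
      exp ?n * (cnj (exp (cinner \<zeta> (S \<eta>) - ?n)) * cinner ?f (expvec \<Phi> (\<zeta> - S \<eta>)))"
    by (simp only: cinner_scaleC_left cinner_scaleC_right isometry_cinner[OF W] mult.left_commute)
  also have "\<dots> = exp ?n * exp (cinner (S \<eta>) \<zeta> - ?n) * cnj (amplitude \<Phi> T (\<zeta> - S \<eta>))"
    by (simp add: amplitude_def exp_cnj flip: cinner_commute)
  also have "exp ?n * exp (cinner (S \<eta>) \<zeta> - ?n) = exp (cinner (S \<eta>) \<zeta>)"
    by (simp flip: exp_add)
  finally show ?thesis .
qed

text \<open>Consider \<open>z \<mapsto> amplitude T (\<zeta> - z S \<eta>)\<close>. It is holomorphic because \<open>e(\<zeta> + z \<omega>)\<close> is a scalar multiple,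
  holomorphic in \<open>z\<close>, of \<open>W(\<zeta>) e(z \<omega>)\<close>. Its conjugate is holomorphic by \<open>intertwiner_matrix\<close>. So it
  is constant.\<close>

lemma amplitude_shift:
  assumes S: "isometry_op S" and T: "intertwiner \<Phi> S T"
  shows "amplitude \<Phi> T (\<zeta> + S \<eta>) = amplitude \<Phi> T \<zeta>"
proof -
  have bT: "T \<in> bounded_op" using T by (simp add: intertwiner_def)
  have bS: "S \<in> bounded_op" using S by (simp add: isometry_op_def)
  let ?u = "\<lambda>z. amplitude \<Phi> T (\<zeta> + scaleC z (- S \<eta>))"
  have "?u field_differentiable (at z)" for z
  proof -
    have "?u z = exp (of_real ((norm \<zeta>)\<^sup>2 / 2) + z * cinner (- S \<eta>) \<zeta>) *
        cinner (weyl \<Phi> \<zeta> (expvec \<Phi> (scaleC z (- S \<eta>)))) (T (expvec \<Phi> 0))" for z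
      unfolding amplitude_def expvec_add_eq_weyl cinner_scaleC_left ..
    then show ?thesis
      by (simp only:) (intro field_differentiable_mult exp_affine_differentiable entire_expvec weyl_bounded)
  qed
  moreover have "(\<lambda>z. cnj (?u z)) field_differentiable (at z)" for z
  proof -
    have "cnj (?u z) = exp (0 + z * (- cinner (S \<eta>) \<zeta>)) * cinner (T (expvec \<Phi> (scaleC z \<eta>))) (expvec \<Phi> \<zeta>)" for z
      by (simp add: intertwiner_matrix[OF S T] bounded_op_scaleC[OF bS] cinner_scaleC_left exp_minus)
    then show ?thesis
      by (simp only:) (intro field_differentiable_mult exp_affine_differentiable entire_expvec bT)
  qed
  ultimately have "?u (-1) = ?u 0" by (rule constant_if_cnj_differentiable)
  then show ?thesis by simp
qed

text \<open>By shift invariance the amplitude in \<open>intertwiner_matrix\<close> no longer depends on \<open>\<eta>\<close>, and what remains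
  is an inner product of two exponential vectors.\<close>

lemma cadjoint_intertwiner_expvec:
  assumes S: "isometry_op S" and T: "intertwiner \<Phi> S T"
  shows "cadjoint T (expvec \<Phi> \<zeta>) = scaleC (amplitude \<Phi> T \<zeta>) (expvec \<Phi> (cadjoint S \<zeta>))"
proof (rule expvec_eqI[OF fock])
  fix \<eta>
  have bT: "T \<in> bounded_op" using T by (simp add: intertwiner_def)
  have bS: "S \<in> bounded_op" using S by (simp add: isometry_op_def)
  have "amplitude \<Phi> T (\<zeta> - S \<eta>) = amplitude \<Phi> T \<zeta>"
    using amplitude_shift[OF S T, of "\<zeta> - S \<eta>" \<eta>] by simp
  then show "cinner (expvec \<Phi> \<eta>) (cadjoint T (expvec \<Phi> \<zeta>)) =
      cinner (expvec \<Phi> \<eta>) (scaleC (amplitude \<Phi> T \<zeta>) (expvec \<Phi> (cadjoint S \<zeta>)))"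
    by (simp add: intertwiner_matrix[OF S T] cinner_scaleC_right cinner_expvec[OF fock] cadjoint(2)[OF bS]
        flip: cadjoint(2)[OF bT])
qed

text \<open>Move \<open>v\<close> to the other side of the inner product and apply \<open>cadjoint_intertwiner_expvec\<close>.\<close>

lemma amplitude_comp:
  assumes S: "isometry_op S" and v: "intertwiner \<Phi> S v"
  shows "amplitude \<Phi> (v \<circ> w) \<zeta> = amplitude \<Phi> v \<zeta> * amplitude \<Phi> w (cadjoint S \<zeta>)"
proof -
  have bv: "v \<in> bounded_op" using v by (simp add: intertwiner_def)
  have "amplitude \<Phi> (v \<circ> w) \<zeta> = cnj (cinner (v (w (expvec \<Phi> 0))) (expvec \<Phi> \<zeta>))"
    by (simp add: amplitude_def flip: cinner_commute)
  also have "\<dots> = cinner (cadjoint v (expvec \<Phi> \<zeta>)) (w (expvec \<Phi> 0))"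
    by (simp add: cadjoint(2)[OF bv] flip: cinner_commute)
  finally show ?thesis
    by (simp add: cadjoint_intertwiner_expvec[OF S v] amplitude_def cinner_scaleC_left)
qed

text \<open>By \<open>intertwiner_matrix\<close> and shift invariance an intertwiner is determined by its value at the
  vacuum. Dividing \<open>T\<close> by \<open>c\<close> therefore exhibits the operator that \<open>exp_op\<close> describes, and its uniqueness
  is the totality of the exponential vectors.\<close>

lemma intertwiner_eq_exp_op:
  assumes S: "isometry_op S" and T: "intertwiner \<Phi> S T"
    and vac: "T (expvec \<Phi> 0) = scaleC c (expvec \<Phi> \<xi>)" and c: "c \<noteq> 0" and \<xi>: "cadjoint S \<xi> = 0"
  shows "T = op_scale c (exp_op \<Phi> S \<xi>)"
proof -
  have bT: "T \<in> bounded_op" using T by (simp add: intertwiner_def)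
  have bS: "S \<in> bounded_op" using S by (simp add: isometry_op_def)
  have \<xi>0: "cinner (S \<eta>) \<xi> = 0" "cinner \<xi> (S \<eta>) = 0" for \<eta>
    using cadjoint(2)[OF bS, of \<eta> \<xi>] cinner_commute[of \<xi> "S \<eta>"] by (simp_all add: \<xi>)
  have T_exp: "T (expvec \<Phi> \<eta>) = scaleC c (expvec \<Phi> (\<xi> + S \<eta>))" for \<eta>
  proof (rule expvec_eqI[OF fock])
    fix \<zeta>
    have "amplitude \<Phi> T (\<zeta> - S \<eta>) = amplitude \<Phi> T \<zeta>"
      using amplitude_shift[OF S T, of "\<zeta> - S \<eta>" \<eta>] by simp
    then have "cinner (T (expvec \<Phi> \<eta>)) (expvec \<Phi> \<zeta>) = exp (cinner (S \<eta>) \<zeta>) * (c * exp (cinner \<xi> \<zeta>))"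
      by (simp add: intertwiner_matrix[OF S T] amplitude_def vac cinner_scaleC_right
          cinner_expvec[OF fock] exp_cnj cinner_diff_left cinner_diff_right \<xi>0 flip: cinner_commute)
    also have "\<dots> = cinner (scaleC c (expvec \<Phi> (\<xi> + S \<eta>))) (expvec \<Phi> \<zeta>)"
      by (simp add: cinner_scaleC_left cinner_expvec[OF fock] cinner_add_left exp_add)
    finally show "cinner (expvec \<Phi> \<zeta>) (T (expvec \<Phi> \<eta>)) =
        cinner (expvec \<Phi> \<zeta>) (scaleC c (expvec \<Phi> (\<xi> + S \<eta>)))"
      by (metis cinner_commute)
  qed
  let ?P = "\<lambda>U. U \<in> bounded_op \<and> (\<forall>\<eta>. U (expvec \<Phi> \<eta>) = expvec \<Phi> (\<xi> + S \<eta>))"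
  define U where "U = op_scale (1 / c) T"
  obtain K where K: "\<And>x. norm (T x) \<le> norm x * K"
    using bounded_linear.bounded[OF bounded_op_linear[OF bT]] by auto
  have "U \<in> bounded_op"
  proof (rule bounded_opI)
    fix x
    have "norm (U x) = cmod (1 / c) * norm (T x)" by (simp add: U_def op_scale_def norm_scaleC)
    also have "\<dots> \<le> cmod (1 / c) * (norm x * K)" by (intro mult_left_mono K) simp
    finally show "norm (U x) \<le> norm x * (cmod (1 / c) * K)" by (simp add: mult_ac)
  qed (simp_all add: U_def op_scale_def bounded_op_add[OF bT] bounded_op_scaleC[OF bT]
      scaleC_add_right scaleC_scaleC mult.commute)
  then have U: "?P U" using c by (simp add: U_def op_scale_def T_exp scaleC_scaleC)
  have "(THE U. ?P U) = U"
  proof (rule the_equality)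
    show "W = U" if "?P W" for W
      by (rule bounded_op_eqI_expvec[OF fock]) (use that U in auto)
  qed (rule U)
  then have "exp_op \<Phi> S \<xi> = U" by (simp add: exp_op_def)
  then show ?thesis using c by (simp add: U_def op_scale_def scaleC_scaleC fun_eq_iff)
qed

end

lemma product_fibre_intertwiner:
  fixes \<Phi> :: "'h::chilbert_space list \<Rightarrow> 'f::chilbert_space"
  assumes "symmetric_fock_space \<Phi>" "ccr_flow \<Phi> V \<alpha>" "t \<ge> 0" "T \<in> product_fibre \<alpha> t"
  shows "intertwiner \<Phi> (V t) T"
proof -
  have "weyl \<Phi> (V t \<xi>) \<circ> T = T \<circ> weyl \<Phi> \<xi>" for \<xi>
  proof -
    have "\<alpha> t (weyl \<Phi> \<xi>) \<circ> T = T \<circ> weyl \<Phi> \<xi>"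
      using assms(4) weyl_bounded[OF assms(1)] unfolding product_fibre_def by blast
    then show ?thesis using assms(2,3) by (simp add: ccr_flow_def)
  qed
  then show ?thesis using assms(4) by (simp add: intertwiner_def product_fibre_def)
qed

section \<open>Range projections of a semigroup of isometries\<close>

text \<open>A strongly continuous decreasing path of orthogonal projections, starting at the identity. Linearity
  of \<open>Q s\<close> is a consequence of self-adjointness.\<close>

locale projection_path =
  fixes Q :: "real \<Rightarrow> 'h::chilbert_space \<Rightarrow> 'h" and t :: real
  assumes t: "0 \<le> t"
    and Q_0: "Q 0 x = x"
    and Q_self_adjoint: "\<lbrakk>0 \<le> s; s \<le> t\<rbrakk> \<Longrightarrow> cinner (Q s x) y = cinner x (Q s y)"
    and Q_Q_le: "\<lbrakk>0 \<le> a; a \<le> b; b \<le> t\<rbrakk> \<Longrightarrow> Q a (Q b x) = Q b x"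
    and Q_continuous: "continuous_on {0..t} (\<lambda>s. Q s x)"
begin

lemma Q_Q_ge:
  assumes "0 \<le> a" "a \<le> b" "b \<le> t"
  shows "Q b (Q a x) = Q b x"
  by (rule cinner_eqI) (use assms in \<open>simp add: Q_self_adjoint[symmetric] Q_Q_le\<close>)

lemma Q_diff:
  assumes "0 \<le> s" "s \<le> t"
  shows "Q s (x - y) = Q s x - Q s y"
  by (rule cinner_eqI) (simp add: cinner_diff_right assms flip: Q_self_adjoint)

lemma norm_Q_diff_sq:
  assumes "0 \<le> a" "a \<le> b" "b \<le> t"
  shows "(norm (Q a x - Q b x))\<^sup>2 = (norm (Q a x))\<^sup>2 - (norm (Q b x))\<^sup>2"
proof -
  have "cinner (Q a x) (Q b x) = cinner (Q b x) (Q b x)"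
    using assms by (simp add: Q_self_adjoint Q_Q_le Q_Q_ge)
  then show ?thesis by (simp only: norm_diff_sq) (simp add: norm_sq_cinner)
qed

text \<open>The component over the interval from \<open>a\<close> to \<open>b\<close>, that is, the increment of the spectral resolution
  \<open>1 - Q s\<close>.\<close>

definition piece :: "real \<Rightarrow> real \<Rightarrow> 'h \<Rightarrow> 'h" where
  "piece a b x = Q a x - Q b x"

lemma cinner_piece_left:
  assumes "0 \<le> a" "a \<le> b" "b \<le> t"
  shows "cinner (piece a b x) y = cinner (piece a b x) (piece a b y)"
  using assms by (simp add: piece_def cinner_diff_left cinner_diff_right Q_self_adjoint Q_Q_le Q_Q_ge)

lemma cinner_piece_disjoint:
  assumes "0 \<le> a" "a \<le> b" "b \<le> c" "c \<le> d" "d \<le> t"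
  shows "cinner (piece a b x) (piece c d y) = 0"
  using assms by (simp add: piece_def cinner_diff_left cinner_diff_right Q_self_adjoint Q_Q_le Q_Q_ge)

end

lemma cadjoint_isometry_left_inverse:
  assumes "isometry_op (S :: 'a::chilbert_space \<Rightarrow> 'a)"
  shows "cadjoint S (S x) = x"
  by (rule cinner_eqI) (use assms in \<open>simp add: isometry_op_def isometry_cinner flip: cadjoint(2)\<close>)

lemma norm_range_projection_le:
  assumes S: "isometry_op (S :: 'a::chilbert_space \<Rightarrow> 'a)"
  shows "norm (S (cadjoint S x)) \<le> norm x"
proof -
  let ?y = "cadjoint S x"
  have b: "S \<in> bounded_op" and n: "norm (S y) = norm y" for y
    using S by (auto simp: isometry_op_def)
  have "(norm ?y)\<^sup>2 = Re (cinner (S ?y) x)" by (simp add: norm_sq_cinner cadjoint(2)[OF b])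
  also have "\<dots> \<le> norm ?y * norm x"
    using cauchy_schwarz[of "S ?y" x] complex_Re_le_cmod[of "cinner (S ?y) x"] by (simp add: n)
  finally have "norm ?y \<le> norm x"
    by (cases "?y = 0") (simp_all add: power2_eq_square)
  then show ?thesis by (simp add: n)
qed

text \<open>The point is strong continuity of \<open>Q s = V s V s\<^sup>*\<close>, both from the left and from the right. From
  \<open>Q (a + h) V h = V h Q a\<close> one gets \<open>\<parallel>Q a x\<parallel> - \<parallel>Q (a + h) x\<parallel> \<le> \<parallel>x - V h x\<parallel>\<close> uniformly in \<open>a\<close>, and since
  the projections decrease, \<open>\<parallel>Q a x - Q (a + h) x\<parallel>\<^sup>2\<close> is the difference of the squares of these norms.\<close>

lemma isometry_semigroup_projection_path:
  fixes V :: "real \<Rightarrow> 'h::chilbert_space \<Rightarrow> 'h"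
  assumes V: "isometry_semigroup V" and t: "0 \<le> t"
  shows "projection_path (\<lambda>s. V s \<circ> cadjoint (V s)) t"
proof -
  define Q where "Q s x = V s (cadjoint (V s) x)" for s x
  have iso: "isometry_op (V s)" if "s \<ge> 0" for s
    using V that by (simp add: isometry_semigroup_def)
  have b: "V s \<in> bounded_op" if "s \<ge> 0" for s
    using iso[OF that] by (simp add: isometry_op_def)
  have n: "norm (V s x) = norm x" if "s \<ge> 0" for s x
    using iso[OF that] by (simp add: isometry_op_def)
  have left: "cadjoint (V s) (V s x) = x" if "s \<ge> 0" for s x
    by (rule cadjoint_isometry_left_inverse[OF iso[OF that]])
  have add: "V (r + s) x = V r (V s x)" if "r \<ge> 0" "s \<ge> 0" for r s x
    using V that by (simp add: isometry_semigroup_def)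
  have V0: "V 0 = id" using V by (simp add: isometry_semigroup_def)
  have Q_norm: "norm (Q s x) \<le> norm x" if "s \<ge> 0" for s x
    unfolding Q_def by (rule norm_range_projection_le[OF iso[OF that]])
  have Q_diff: "Q s (x - y) = Q s x - Q s y" if "s \<ge> 0" for s x y
    using bounded_linear.linear[OF bounded_op_linear[OF b[OF that]]]
      bounded_linear.linear[OF bounded_op_linear[OF cadjoint(1)[OF b[OF that]]]]
    by (simp add: Q_def linear_diff)
  have Q_sa: "cinner (Q s x) y = cinner x (Q s y)" if "s \<ge> 0" for s x y
  proof -
    have "cinner x (Q s y) = cnj (cinner (V s (cadjoint (V s) y)) x)"
      by (simp add: Q_def flip: cinner_commute)
    then show ?thesis
      by (simp add: Q_def cadjoint(2)[OF b[OF that]] flip: cinner_commute)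
  qed
  have Q_Q: "Q a (Q s x) = Q s x" if "0 \<le> a" "a \<le> s" for a s x
  proof -
    have "Q s x = V a (V (s - a) (cadjoint (V s) x))"
      using add[of a "s - a"] that by (simp add: Q_def)
    then show ?thesis using that by (simp add: Q_def left)
  qed
  have Q_Q': "Q s (Q a x) = Q s x" if "0 \<le> a" "a \<le> s" for a s x
    by (rule cinner_eqI) (use that in \<open>simp add: Q_Q flip: Q_sa\<close>)
  have adj: "cadjoint (V (a + h)) (V h x) = cadjoint (V a) x" if "a \<ge> 0" "h \<ge> 0" for a h x
    by (rule cinner_eqI)
      (use that add[of h a] in \<open>simp add: isometry_cinner[OF iso] add.commute b flip: cadjoint(2)\<close>)
  have shift: "Q (a + h) (V h x) = V h (Q a x)" if "a \<ge> 0" "h \<ge> 0" for a h x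
    using that add[of h a] by (simp add: Q_def adj add.commute)
  have modulus: "(norm (Q a x - Q (a + h) x))\<^sup>2 \<le> 2 * norm x * norm (x - V h x)"
    if "a \<ge> 0" "h \<ge> 0" for a h x
  proof -
    have "norm (Q a x) = norm (Q (a + h) (V h x))" using that by (simp add: shift n)
    also have "\<dots> \<le> norm (Q (a + h) x) + norm (Q (a + h) x - Q (a + h) (V h x))"
      using norm_triangle_sub norm_minus_commute by metis
    also have "norm (Q (a + h) x - Q (a + h) (V h x)) \<le> norm (x - V h x)"
      using Q_norm[of "a + h" "x - V h x"] that by (simp add: Q_diff)
    finally have d: "norm (Q a x) - norm (Q (a + h) x) \<le> norm (x - V h x)" by simp
    have le: "norm (Q (a + h) x) \<le> norm (Q a x)"
      using Q_norm[of "a + h" "Q a x"] that by (simp add: Q_Q')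
    have c: "cinner (Q a x) (Q (a + h) x) = cinner (Q (a + h) x) (Q (a + h) x)"
      using that by (simp add: Q_sa Q_Q Q_Q')
    have "(norm (Q a x - Q (a + h) x))\<^sup>2 = (norm (Q a x))\<^sup>2 - (norm (Q (a + h) x))\<^sup>2"
      using c by (simp only: norm_diff_sq) (simp add: norm_sq_cinner)
    also have "\<dots> = (norm (Q a x) + norm (Q (a + h) x)) * (norm (Q a x) - norm (Q (a + h) x))"
      by (simp add: power2_eq_square algebra_simps)
    also have "\<dots> \<le> (norm x + norm x) * norm (x - V h x)"
      using that le by (intro mult_mono add_mono Q_norm d) auto
    finally show ?thesis by simp
  qed
  have cont: "continuous_on {0..t} (\<lambda>s. Q s x)" for x
    unfolding continuous_on_iff
  proof (intro ballI allI impI)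
    fix s e :: real assume s: "s \<in> {0..t}" and e: "e > 0"
    define e' where "e' = e\<^sup>2 / (2 * norm x + 1)"
    have pos: "2 * norm x + 1 > 0" using norm_ge_zero[of x] by linarith
    have "e' > 0" using e pos by (simp add: e'_def)
    moreover have "continuous_on {0..} (\<lambda>h. V h x)" using V by (simp add: isometry_semigroup_def)
    ultimately obtain d where d: "d > 0" and dV: "\<And>h. \<lbrakk>h \<ge> 0; h < d\<rbrakk> \<Longrightarrow> norm (V h x - x) < e'"
      unfolding continuous_on_iff dist_norm
      by (metis V0 abs_of_nonneg atLeast_iff diff_zero id_apply order_refl real_norm_def)
    have close: "norm (Q a x - Q (a + h) x) < e" if "a \<ge> 0" "h \<ge> 0" "h < d" for a h
    proof -
      have "(norm (Q a x - Q (a + h) x))\<^sup>2 \<le> 2 * norm x * norm (x - V h x)"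
        using that by (intro modulus)
      also have "\<dots> \<le> 2 * norm x * e'"
        using dV[of h] that by (intro mult_left_mono) (auto simp: norm_minus_commute)
      also have "\<dots> < (2 * norm x + 1) * e'" using \<open>e' > 0\<close> by simp
      also have "\<dots> = e\<^sup>2" using pos by (simp add: e'_def)
      finally show ?thesis using e power_less_imp_less_base by fastforce
    qed
    have "dist (Q r x) (Q s x) < e" if r: "r \<in> {0..t}" "dist r s < d" for r
    proof (cases "r \<le> s")
      case True
      then show ?thesis using close[of r "s - r"] r by (auto simp: dist_norm dist_real_def)
    next
      case False
      then show ?thesis using close[of s "r - s"] r s
        by (auto simp: dist_norm dist_real_def norm_minus_commute)
    qed
    then show "\<exists>d>0. \<forall>r\<in>{0..t}. dist r s < d \<longrightarrow> dist (Q r x) (Q s x) < e" using d by blast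
  qed
  have "projection_path Q t"
  proof
    show "Q 0 x = x" for x using left[of 0 x] by (simp add: Q_def V0)
  qed (use t in \<open>simp_all add: Q_sa Q_Q cont\<close>)
  moreover have "Q = (\<lambda>s. V s \<circ> cadjoint (V s))" by (simp add: Q_def fun_eq_iff)
  ultimately show ?thesis by simp
qed

section \<open>Factorising amplitudes are exponential\<close>

text \<open>Take \<open>L\<close> to be the sum of the principal logarithms of the factors, each of which differs from \<open>a i\<close>
  to second order.\<close>

lemma prod_close_to_exp:
  fixes a :: "'i \<Rightarrow> complex"
  assumes "\<And>i. i \<in> A \<Longrightarrow> cmod (a i) \<le> 1/2"
  shows "\<exists>L. exp L = (\<Prod>i\<in>A. 1 + a i) \<and> cmod (L - (\<Sum>i\<in>A. a i)) \<le> 2 * (\<Sum>i\<in>A. (cmod (a i))\<^sup>2)"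
proof (cases "finite A")
  case True
  let ?L = "\<Sum>i\<in>A. ln (1 + a i)"
  have "1 + a i \<noteq> 0" if "i \<in> A" for i
  proof
    assume "1 + a i = 0"
    then have "a i = -1" by (simp add: add_eq_0_iff)
    then show False using assms[OF that] by simp
  qed
  then have "exp ?L = (\<Prod>i\<in>A. 1 + a i)"
    using True by (simp add: exp_sum)
  moreover have "cmod (?L - (\<Sum>i\<in>A. a i)) \<le> 2 * (\<Sum>i\<in>A. (cmod (a i))\<^sup>2)"
  proof -
    have "cmod (ln (1 + a i) - a i) \<le> 2 * (cmod (a i))\<^sup>2" if "i \<in> A" for i
    proof -
      have "cmod (ln (1 + a i) - a i) \<le> (cmod (a i))\<^sup>2 / (1 - cmod (a i))"
        using assms[OF that] by (intro Ln_approx_linear) simp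
      also have "\<dots> \<le> (cmod (a i))\<^sup>2 / (1/2)"
        using assms[OF that] by (intro divide_left_mono) auto
      finally show ?thesis by simp
    qed
    then show ?thesis
      unfolding sum_subtractf[symmetric] sum_distrib_left by (rule sum_norm_le)
  qed
  ultimately show ?thesis by blast
qed (auto intro: exI[of _ 0])

lemma norm_sum_orthogonal_sq:
  fixes x :: "'i \<Rightarrow> 'a::complex_inner"
  assumes "\<And>i j. \<lbrakk>i \<in> A; j \<in> A; i \<noteq> j\<rbrakk> \<Longrightarrow> cinner (x i) (x j) = 0"
  shows "(norm (\<Sum>i\<in>A. x i))\<^sup>2 = (\<Sum>i\<in>A. (norm (x i))\<^sup>2)"
proof (cases "finite A")
  case True
  have "cinner (\<Sum>i\<in>A. x i) (\<Sum>i\<in>A. x i) = (\<Sum>i\<in>A. \<Sum>j\<in>A. if i = j then cinner (x i) (x i) else 0)"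
    unfolding cinner_sum_left cinner_sum_right
    by (subst sum.swap) (intro sum.cong refl, auto simp: assms)
  also have "\<dots> = (\<Sum>i\<in>A. cinner (x i) (x i))" using True by simp
  finally show ?thesis by (simp add: norm_sq_cinner)
qed simp

context
  fixes \<Phi> :: "'h::chilbert_space list \<Rightarrow> 'f::chilbert_space"
  assumes fock: "symmetric_fock_space \<Phi>"
begin

lemma cinner_expvec_one: "cinner (expvec \<Phi> \<zeta>) (\<Phi> [\<eta>]) = cinner \<zeta> \<eta>"
proof -
  have lin: "bounded_linear (\<lambda>x. cinner x (\<Phi> [\<eta>]))"
    by (rule bounded_linear_intro[of _ "norm (\<Phi> [\<eta>])"])
      (simp_all add: cinner_add_left cinner_scaleR_left scaleR_conv_of_real cauchy_schwarz)
  have "cinner ((1 / sqrt (fact n)) *\<^sub>R \<Phi> (replicate n \<zeta>)) (\<Phi> [\<eta>]) = (if n = 1 then cinner \<zeta> \<eta> else 0)" for n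
    using fock_power[OF fock, of n \<zeta> 1 \<eta>] by (simp add: cinner_scaleR_left)
  then have "(\<lambda>n. if n = 1 then cinner \<zeta> \<eta> else 0) sums cinner (expvec \<Phi> \<zeta>) (\<Phi> [\<eta>])"
    using bounded_linear.sums[OF lin expvec_sums[OF fock, of \<zeta>]] by simp
  moreover have "(\<lambda>n. if n = 1 then cinner \<zeta> \<eta> else 0) sums cinner \<zeta> \<eta>"
    by (rule sums_single)
  ultimately show ?thesis by (rule sums_unique2)
qed

lemma cinner_one_one: "cinner (\<Phi> [\<zeta>]) (\<Phi> [\<eta>]) = cinner \<zeta> \<eta>"
  using fock_power[OF fock, of 1 \<zeta> 1 \<eta>] by simp

lemma cinner_one_expvec: "cinner (\<Phi> [\<zeta>]) (expvec \<Phi> \<eta>) = cinner \<zeta> \<eta>"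
  by (metis cinner_commute cinner_expvec_one)

text \<open>The embedding \<open>\<zeta> \<mapsto> \<Phi> [\<zeta>]\<close> of the one-particle space is a linear isometry, so the functional on
  the left is bounded and has a representing vector.\<close>

lemma one_particle_component:
  obtains \<xi> where "\<And>\<zeta>. cinner (\<Phi> [\<zeta>]) g = cinner \<zeta> \<xi>"
proof -
  have "\<exists>\<xi>. \<forall>\<zeta>. cinner (\<Phi> [\<zeta>]) g = cinner \<zeta> \<xi>"
  proof (rule riesz_representation[where K = "norm g"])
    have "\<Phi> [x + y] = \<Phi> [x] + \<Phi> [y]" for x y
      by (rule expvec_eqI[OF fock]) (simp add: cinner_expvec_one cinner_add_right)
    then show "cinner (\<Phi> [x + y]) g = cinner (\<Phi> [x]) g + cinner (\<Phi> [y]) g" for x y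
      by (simp add: cinner_add_left)
    have "\<Phi> [scaleC c x] = scaleC c (\<Phi> [x])" for c x
      by (rule expvec_eqI[OF fock]) (simp add: cinner_expvec_one cinner_scaleC_right)
    then show "cinner (\<Phi> [scaleC c x]) g = c * cinner (\<Phi> [x]) g" for c x
      by (simp add: cinner_scaleC_left)
    have "(norm (\<Phi> [x]))\<^sup>2 = (norm x)\<^sup>2" for x
      by (simp add: norm_sq_cinner cinner_one_one)
    then have "norm (\<Phi> [x]) = norm x" for x by (simp add: power2_eq_iff_nonneg)
    then show "cmod (cinner (\<Phi> [x]) g) \<le> norm g * norm x" for x
      using cauchy_schwarz[of "\<Phi> [x]" g] by (simp add: mult.commute)
  qed
  then show ?thesis using that by blast
qed

text \<open>The part of the exponential vector of particle number at least two.\<close>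

definition remainder :: "'h \<Rightarrow> 'f" where
  "remainder \<zeta> = expvec \<Phi> \<zeta> - expvec \<Phi> 0 - \<Phi> [\<zeta>]"

text \<open>Dropping the first two terms of the exponential series makes remainders of orthogonal vectors
  orthogonal, and the remainder of second order in \<open>\<zeta>\<close>.\<close>

lemma cinner_remainder:
  "cinner (remainder \<zeta>) (remainder \<eta>) = exp (cinner \<zeta> \<eta>) - 1 - cinner \<zeta> \<eta>"
  by (simp add: remainder_def cinner_diff_left cinner_diff_right cinner_expvec[OF fock]
      cinner_expvec_one cinner_one_expvec cinner_one_one)

lemma norm_remainder_le:
  assumes "norm \<zeta> \<le> 1"
  shows "norm (remainder \<zeta>) \<le> (norm \<zeta>)\<^sup>2"
proof -
  have "cinner (remainder \<zeta>) (remainder \<zeta>) = of_real (exp ((norm \<zeta>)\<^sup>2) - 1 - (norm \<zeta>)\<^sup>2)"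
    unfolding cinner_remainder cinner_self[of \<zeta>] exp_of_real of_real_diff of_real_1 ..
  then have "(norm (remainder \<zeta>))\<^sup>2 = exp ((norm \<zeta>)\<^sup>2) - 1 - (norm \<zeta>)\<^sup>2"
    by (simp only: norm_sq_cinner[of "remainder \<zeta>"] Re_complex_of_real)
  also have "\<dots> \<le> ((norm \<zeta>)\<^sup>2)\<^sup>2"
    using exp_bound[of "(norm \<zeta>)\<^sup>2"] assms by (simp add: power_le_one)
  finally show ?thesis by (rule power2_le_imp_le) simp
qed

text \<open>In what follows \<open>\<phi>\<close> is the amplitude of \<open>f\<close>. The exchange relation says that \<open>\<phi>\<close> is a product of
  a function of the component in the kernel of \<open>Q s\<close> and a function of the component in its range; in
  this form it needs no division by values of \<open>\<phi>\<close>, which are not yet known to be nonzero.\<close>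

context
  fixes Q :: "real \<Rightarrow> 'h \<Rightarrow> 'h" and t :: real and f :: 'f and \<phi> :: "'h \<Rightarrow> complex"
  assumes path: "projection_path Q t"
    and phi: "\<phi> = (\<lambda>\<zeta>. cinner (expvec \<Phi> \<zeta>) f)"
    and exchange: "\<And>s x y. \<lbrakk>0 \<le> s; s \<le> t\<rbrakk> \<Longrightarrow> \<phi> x * \<phi> y = \<phi> (x - Q s x + Q s y) * \<phi> (y - Q s y + Q s x)"
    and invariant: "\<And>x. \<phi> (x - Q t x) = \<phi> x"
begin

interpretation projection_path Q t by (rule path)

lemma isCont_phi: "isCont \<phi> x"
  unfolding phi isCont_def
  by (intro tendsto_cinner tendsto_const) (use isCont_expvec[OF fock] in \<open>simp add: isCont_def\<close>)

text \<open>Let \<open>\<phi> \<omega> \<noteq> 0\<close>. The exchange relation shows that deleting the component of \<open>\<omega>\<close> over two adjacent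
  intervals gives a nonzero amplitude if deleting either one does, and by continuity this holds for short
  intervals. By Bolzano's bisection principle it holds for the whole interval, where only the
  component in the range of \<open>Q t\<close> is left, which \<open>\<phi>\<close> does not see.\<close>

lemma vacuum_amplitude_nonzero:
  assumes "f \<noteq> 0"
  shows "\<phi> 0 \<noteq> 0"
proof -
  have "\<exists>\<omega>. \<phi> \<omega> \<noteq> 0"
  proof (rule ccontr)
    assume "\<not> ?thesis"
    then have "f = 0" by (intro expvec_eqI[OF fock]) (simp add: phi)
    then show False using assms by simp
  qed
  then obtain \<omega> where \<omega>: "\<phi> \<omega> \<noteq> 0" ..
  obtain e where e: "e > 0" and near: "\<And>u. norm u < e \<Longrightarrow> \<phi> (\<omega> - u) \<noteq> 0"
  proof -
    obtain e where "e > 0" "\<And>y. dist \<omega> y < e \<Longrightarrow> \<phi> y \<noteq> 0"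
      using continuous_at_avoid[OF isCont_phi \<omega>] by blast
    then show ?thesis by (intro that[of e]) (auto simp: dist_norm)
  qed
  define P where "P a b \<longleftrightarrow> (0 \<le> a \<and> b \<le> t \<longrightarrow> \<phi> (\<omega> - piece a b \<omega>) \<noteq> 0)" for a b
  have "P 0 t"
    using t
  proof (induction rule: Bolzano)
    case (trans a b c)
    show ?case
      unfolding P_def
    proof
      assume ac: "0 \<le> a \<and> c \<le> t"
      let ?x = "\<omega> - piece a c \<omega>"
      have Qx: "Q b ?x = Q c \<omega>" and b: "0 \<le> b" "b \<le> t"
        using ac trans(3,4) by (auto simp: piece_def Q_diff Q_Q_le Q_Q_ge)
      have "\<phi> ?x * \<phi> \<omega> = \<phi> (\<omega> - piece a b \<omega>) * \<phi> (\<omega> - piece b c \<omega>)"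
        using exchange[OF b, of ?x \<omega>] unfolding Qx by (simp add: piece_def algebra_simps)
      moreover have "\<phi> (\<omega> - piece a b \<omega>) \<noteq> 0" "\<phi> (\<omega> - piece b c \<omega>) \<noteq> 0"
        using trans(1,2) ac b by (auto simp: P_def)
      ultimately show "\<phi> ?x \<noteq> 0" by force
    qed
  next
    case (local x)
    then obtain d where d: "d > 0" and dQ: "\<And>s. \<lbrakk>0 \<le> s; s \<le> t; \<bar>s - x\<bar> < d\<rbrakk> \<Longrightarrow> norm (Q s \<omega> - Q x \<omega>) < e / 2"
      using Q_continuous[of \<omega>] e unfolding continuous_on_iff dist_norm
      by (metis atLeastAtMost_iff half_gt_zero real_norm_def)
    have "P a b" if "a \<le> x" "x \<le> b" "b - a < d" for a b
      unfolding P_def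
    proof
      assume "0 \<le> a \<and> b \<le> t"
      then have "norm (Q a \<omega> - Q x \<omega>) < e / 2" "norm (Q b \<omega> - Q x \<omega>) < e / 2"
        using that by (auto intro!: dQ simp del: less_divide_eq_numeral1)
      then have "norm (piece a b \<omega>) < e"
        unfolding piece_def using norm_diff_triangle_less[of "Q a \<omega>" "Q x \<omega>" "e/2" "Q b \<omega>" "e/2"]
        by (simp add: norm_minus_commute)
      then show "\<phi> (\<omega> - piece a b \<omega>) \<noteq> 0" by (rule near)
    qed
    then show ?case using d by blast
  qed
  then have "\<phi> (Q t \<omega>) \<noteq> 0" using t by (simp add: P_def piece_def Q_0)
  moreover have "\<phi> (Q t \<omega>) = \<phi> 0"
    using invariant[of "Q t \<omega>"] t by (simp add: Q_Q_le)
  ultimately show ?thesis by simp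
qed

lemma phi_add:
  assumes "0 \<le> s" "s \<le> t" "Q s x = 0" "Q s y = y"
  shows "\<phi> (x + y) * \<phi> 0 = \<phi> x * \<phi> y"
  using exchange[OF assms(1,2), of x y] assms(3,4) by simp

text \<open>Telescoping of \<open>phi_add\<close>: the first \<open>k\<close> pieces add up to \<open>\<zeta> - Q (p k) \<zeta>\<close>.\<close>

lemma phi_partition:
  fixes p :: "nat \<Rightarrow> real"
  assumes norm1: "\<phi> 0 = 1" and p: "p 0 = 0" "\<And>i. i < n \<Longrightarrow> p i \<le> p (Suc i)" "\<And>i. i \<le> n \<Longrightarrow> 0 \<le> p i \<and> p i \<le> t"
    and k: "k \<le> n"
  shows "\<phi> (\<zeta> - Q (p k) \<zeta>) = (\<Prod>i<k. \<phi> (piece (p i) (p (Suc i)) \<zeta>))"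
  using k
proof (induction k)
  case 0
  then show ?case by (simp add: p(1) Q_0 norm1)
next
  case (Suc k)
  have pk: "0 \<le> p k" "p k \<le> p (Suc k)" "p (Suc k) \<le> t"
    using p(2)[of k] p(3)[of k] p(3)[of "Suc k"] Suc.prems by auto
  have "\<phi> ((\<zeta> - Q (p k) \<zeta>) + piece (p k) (p (Suc k)) \<zeta>) * \<phi> 0 = \<phi> (\<zeta> - Q (p k) \<zeta>) * \<phi> (piece (p k) (p (Suc k)) \<zeta>)"
    by (rule phi_add[of "p k"]) (use pk in \<open>auto simp: piece_def Q_diff Q_Q_le\<close>)
  then show ?case using Suc by (simp add: norm1 piece_def)
qed

lemma fine_partition:
  assumes d: "d > (0::real)"
  obtains n :: nat and p where "p 0 = 0" "p n = t" "\<And>i. i < n \<Longrightarrow> p i \<le> p (Suc i)"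
    "\<And>i. i \<le> n \<Longrightarrow> 0 \<le> p i \<and> p i \<le> t" "\<And>i. i < n \<Longrightarrow> p (Suc i) - p i < d"
proof -
  obtain n :: nat where n: "n > t / d" using reals_Archimedean2 by blast
  then have pos: "real n > 0" using t d divide_nonneg_pos[of t d] by linarith
  define p where "p i = t * i / n" for i :: nat
  show ?thesis
  proof (rule that[of p n])
    fix i assume i: "i \<le> n"
    then have "t * real i \<le> t * real n" using t by (intro mult_left_mono) auto
    then show "0 \<le> p i \<and> p i \<le> t" using pos t by (simp add: p_def field_simps)
  next
    fix i
    have "p (Suc i) - p i = t / n" by (simp add: p_def distrib_left add_divide_distrib)
    moreover have "t / n < d" using n pos d by (simp add: field_simps)
    moreover have "0 \<le> t / n" using t by simp
    ultimately show "p (Suc i) - p i < d" "p i \<le> p (Suc i)" by linarith+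
  qed (use pos in \<open>auto simp: p_def\<close>)
qed

text \<open>The key estimate. On a partition so fine that the pieces of \<open>\<zeta>\<close> and of \<open>\<xi>\<close> have norm less than \<open>\<delta>\<close>, write
  \<open>\<phi>(\<zeta>\<^sub>i) = 1 + a\<^sub>i\<close> with \<open>a\<^sub>i = \<langle>\<zeta>\<^sub>i|\<xi>\<^sub>i\<rangle> + \<langle>r(\<zeta>\<^sub>i)|f\<rangle>\<close>. Each \<open>a\<^sub>i\<close> is \<open>O(\<delta> \<parallel>\<zeta>\<^sub>i\<parallel>)\<close>, and the squares \<open>\<parallel>\<zeta>\<^sub>i\<parallel>\<^sup>2\<close>
  add up to at most \<open>\<parallel>\<zeta>\<parallel>\<^sup>2\<close>, so \<open>\<Sum>\<^sub>i \<bar>a\<^sub>i\<bar>\<^sup>2 = O(\<delta>\<^sup>2)\<close>: the logarithm of the product is \<open>\<Sum>\<^sub>i a\<^sub>i\<close> up to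
  this error. The inner products with \<open>\<xi>\<close> sum up exactly, and orthogonality gives \<open>\<Sum>\<^sub>i r(\<zeta>\<^sub>i)\<close> the norm
  \<open>O(\<delta>)\<close>, where summing the norms would give no more than the bound \<open>\<parallel>\<zeta>\<parallel>\<^sup>2\<close>.\<close>

lemma log_phi_approx:
  assumes norm1: "\<phi> 0 = 1" and \<xi>: "\<And>\<zeta>. cinner (\<Phi> [\<zeta>]) f = cinner \<zeta> \<xi>"
    and \<delta>: "0 < \<delta>" "\<delta> \<le> 1" "(1 + norm f) * \<delta> \<le> 1/2"
  shows "\<exists>L. exp L = \<phi> \<zeta> \<and>
    cmod (L - cinner (\<zeta> - Q t \<zeta>) \<xi>) \<le> \<delta> * (2 * (1 + norm f)\<^sup>2 * (norm \<zeta>)\<^sup>2 + norm f * norm \<zeta>)"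
proof -
  have ucont: "uniformly_continuous_on {0..t} (\<lambda>s. Q s x)" for x
    by (intro compact_uniformly_continuous Q_continuous compact_Icc)
  obtain d where d: "d > 0"
    and piece_small: "\<And>a b. \<lbrakk>0 \<le> a; a \<le> b; b \<le> t; b - a < d\<rbrakk> \<Longrightarrow> norm (piece a b \<zeta>) < \<delta> \<and> norm (piece a b \<xi>) < \<delta>"
  proof -
    have "\<exists>d>0. \<forall>a b. 0 \<le> a \<longrightarrow> a \<le> b \<longrightarrow> b \<le> t \<longrightarrow> b - a < d \<longrightarrow> norm (piece a b x) < \<delta>" for x
    proof -
      obtain d where "d > 0" "\<And>a b. \<lbrakk>a \<in> {0..t}; b \<in> {0..t}; dist b a < d\<rbrakk> \<Longrightarrow> dist (Q b x) (Q a x) < \<delta>"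
        using ucont[of x] \<delta>(1) unfolding uniformly_continuous_on_def by metis
      then show ?thesis
        by (intro exI[of _ d]) (auto simp: piece_def dist_norm dist_real_def norm_minus_commute)
    qed
    from this[of \<zeta>] this[of \<xi>] obtain d1 d2 where "d1 > 0" "d2 > 0"
      "\<And>a b. \<lbrakk>0 \<le> a; a \<le> b; b \<le> t; b - a < d1\<rbrakk> \<Longrightarrow> norm (piece a b \<zeta>) < \<delta>"
      "\<And>a b. \<lbrakk>0 \<le> a; a \<le> b; b \<le> t; b - a < d2\<rbrakk> \<Longrightarrow> norm (piece a b \<xi>) < \<delta>"
      by metis
    then show ?thesis by (intro that[of "min d1 d2"]) auto
  qed
  obtain n :: nat and p where p0: "p 0 = 0" and pn: "p n = t"
    and mono: "\<And>i. i < n \<Longrightarrow> p i \<le> p (Suc i)"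
    and range: "\<And>i. i \<le> n \<Longrightarrow> 0 \<le> p i \<and> p i \<le> t" and step: "\<And>i. i < n \<Longrightarrow> p (Suc i) - p i < d"
    using fine_partition[OF d] by metis
  let ?z = "\<lambda>i. piece (p i) (p (Suc i)) \<zeta>" and ?x = "\<lambda>i. piece (p i) (p (Suc i)) \<xi>"
  have pi: "0 \<le> p i" "p i \<le> p (Suc i)" "p (Suc i) \<le> t" if "i < n" for i
    using mono[OF that] range[of i] range[of "Suc i"] that by auto
  have mono': "p i \<le> p j" if "i \<le> j" "j \<le> n" for i j
    using that by (induction j rule: dec_induct) (auto intro: order_trans[OF _ mono])
  have small: "norm (?z i) \<le> \<delta>" "norm (?x i) \<le> \<delta>" if "i < n" for i
    using piece_small[OF pi[OF that] step[OF that]] by auto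
  have orth: "cinner (?z i) (?z j) = 0" if "i < n" "j < n" "i \<noteq> j" for i j
  proof -
    have *: "cinner (?z i) (?z j) = 0" if "i < j" "j < n" for i j
      using pi[of i] pi[of j] mono'[of "Suc i" j] that by (intro cinner_piece_disjoint) auto
    show ?thesis
    proof (cases "i < j")
      case False
      then have "cinner (?z j) (?z i) = 0" using * that by simp
      then show ?thesis by (metis cinner_commute complex_cnj_zero)
    qed (use * that in simp)
  qed
  have sum_z: "(\<Sum>i<n. ?z i) = \<zeta> - Q t \<zeta>"
    using sum_lessThan_telescope'[of "\<lambda>i. Q (p i) \<zeta>" n] by (simp add: piece_def p0 pn Q_0)
  have sum_sq: "(\<Sum>i<n. (norm (?z i))\<^sup>2) \<le> (norm \<zeta>)\<^sup>2"
  proof -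
    have "(\<Sum>i<n. (norm (?z i))\<^sup>2) = (\<Sum>i<n. (norm (Q (p i) \<zeta>))\<^sup>2 - (norm (Q (p (Suc i)) \<zeta>))\<^sup>2)"
      by (intro sum.cong refl) (use pi in \<open>auto simp: piece_def norm_Q_diff_sq\<close>)
    also have "\<dots> = (norm \<zeta>)\<^sup>2 - (norm (Q t \<zeta>))\<^sup>2"
      using sum_lessThan_telescope'[of "\<lambda>i. (norm (Q (p i) \<zeta>))\<^sup>2" n] by (simp add: p0 pn Q_0)
    finally show ?thesis by simp
  qed
  define a where "a i = \<phi> (?z i) - 1" for i
  have a_split: "a i = cinner (?z i) \<xi> + cinner (remainder (?z i)) f" for i
    using norm1 by (simp add: a_def phi remainder_def cinner_diff_left flip: \<xi>)
  have a_le: "cmod (a i) \<le> (1 + norm f) * \<delta> * norm (?z i)" if i: "i < n" for i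
  proof -
    have "cmod (cinner (?z i) \<xi>) \<le> norm (?z i) * norm (?x i)"
      using cauchy_schwarz cinner_piece_left[OF pi[OF i]] by metis
    also have "\<dots> \<le> norm (?z i) * \<delta>" using small[OF i] by (intro mult_left_mono) auto
    finally have 1: "cmod (cinner (?z i) \<xi>) \<le> \<delta> * norm (?z i)" by (simp add: mult.commute)
    have "cmod (cinner (remainder (?z i)) f) \<le> norm (remainder (?z i)) * norm f" by (rule cauchy_schwarz)
    also have "\<dots> \<le> (norm (?z i))\<^sup>2 * norm f"
      using small[OF i] \<delta>(2) by (intro mult_right_mono norm_remainder_le) auto
    also have "\<dots> \<le> \<delta> * norm (?z i) * norm f"
      using small[OF i] unfolding power2_eq_square by (intro mult_right_mono) auto
    finally have 2: "cmod (cinner (remainder (?z i)) f) \<le> \<delta> * norm (?z i) * norm f" .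
    have "cmod (a i) \<le> cmod (cinner (?z i) \<xi>) + cmod (cinner (remainder (?z i)) f)"
      unfolding a_split by (rule norm_triangle_ineq)
    also have "\<dots> \<le> \<delta> * norm (?z i) + \<delta> * norm (?z i) * norm f" using 1 2 by (rule add_mono)
    finally show ?thesis by (simp add: algebra_simps)
  qed
  have half: "cmod (a i) \<le> 1/2" if i: "i \<in> {..<n}" for i
  proof -
    have "cmod (a i) \<le> (1 + norm f) * \<delta> * norm (?z i)" using a_le i by simp
    also have "\<dots> \<le> (1 + norm f) * \<delta> * 1"
      using small(1)[of i] i \<delta> by (intro mult_left_mono) auto
    finally show ?thesis using \<delta>(3) by simp
  qed
  obtain L where L: "exp L = (\<Prod>i<n. 1 + a i)"
    and L_sum: "cmod (L - (\<Sum>i<n. a i)) \<le> 2 * (\<Sum>i<n. (cmod (a i))\<^sup>2)"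
    using prod_close_to_exp[of "{..<n}" a, OF half] by blast
  have "(\<Sum>i<n. (cmod (a i))\<^sup>2) \<le> (\<Sum>i<n. ((1 + norm f) * \<delta>)\<^sup>2 * (norm (?z i))\<^sup>2)"
    by (intro sum_mono) (metis a_le lessThan_iff norm_ge_zero power_mono power_mult_distrib)
  also have "\<dots> \<le> ((1 + norm f) * \<delta>)\<^sup>2 * (norm \<zeta>)\<^sup>2"
    unfolding sum_distrib_left[symmetric] by (intro mult_left_mono sum_sq) simp
  also have "\<dots> = \<delta>\<^sup>2 * ((1 + norm f)\<^sup>2 * (norm \<zeta>)\<^sup>2)" by (simp add: power_mult_distrib mult_ac)
  also have "\<dots> \<le> \<delta> * ((1 + norm f)\<^sup>2 * (norm \<zeta>)\<^sup>2)"
    using \<delta> by (intro mult_right_mono) (auto simp: power2_eq_square mult_left_le)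
  finally have L_close: "cmod (L - (\<Sum>i<n. a i)) \<le> \<delta> * (2 * (1 + norm f)\<^sup>2 * (norm \<zeta>)\<^sup>2)"
    using L_sum by simp
  have "(norm (\<Sum>i<n. remainder (?z i)))\<^sup>2 = (\<Sum>i<n. (norm (remainder (?z i)))\<^sup>2)"
    by (rule norm_sum_orthogonal_sq) (simp add: cinner_remainder orth)
  also have "\<dots> \<le> (\<Sum>i<n. \<delta>\<^sup>2 * (norm (?z i))\<^sup>2)"
  proof (rule sum_mono)
    fix i assume "i \<in> {..<n}"
    then have i: "i < n" by simp
    have "norm (remainder (?z i)) \<le> (norm (?z i))\<^sup>2"
      using small(1)[OF i] \<delta>(2) by (intro norm_remainder_le) simp
    also have "\<dots> \<le> \<delta> * norm (?z i)"
      using small(1)[OF i] unfolding power2_eq_square by (intro mult_right_mono) auto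
    finally show "(norm (remainder (?z i)))\<^sup>2 \<le> \<delta>\<^sup>2 * (norm (?z i))\<^sup>2"
      by (metis norm_ge_zero power_mono power_mult_distrib)
  qed
  also have "\<dots> \<le> \<delta>\<^sup>2 * (norm \<zeta>)\<^sup>2"
    unfolding sum_distrib_left[symmetric] by (intro mult_left_mono sum_sq) simp
  finally have "(norm (\<Sum>i<n. remainder (?z i)))\<^sup>2 \<le> (\<delta> * norm \<zeta>)\<^sup>2" by (simp add: power_mult_distrib)
  then have "norm (\<Sum>i<n. remainder (?z i)) \<le> \<delta> * norm \<zeta>"
    by (rule power2_le_imp_le) (use \<delta> in simp)
  then have "cmod (cinner (\<Sum>i<n. remainder (?z i)) f) \<le> \<delta> * norm \<zeta> * norm f"
    using cauchy_schwarz mult_right_mono norm_ge_zero order_trans by metis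
  moreover have "(\<Sum>i<n. a i) - cinner (\<zeta> - Q t \<zeta>) \<xi> = cinner (\<Sum>i<n. remainder (?z i)) f"
    by (simp add: a_split sum.distrib cinner_sum_left flip: sum_z)
  ultimately have "cmod ((\<Sum>i<n. a i) - cinner (\<zeta> - Q t \<zeta>) \<xi>) \<le> \<delta> * (norm f * norm \<zeta>)"
    by (simp add: mult_ac)
  with L_close have "cmod (L - cinner (\<zeta> - Q t \<zeta>) \<xi>) \<le>
      \<delta> * (2 * (1 + norm f)\<^sup>2 * (norm \<zeta>)\<^sup>2) + \<delta> * (norm f * norm \<zeta>)"
    by (rule norm_diff_triangle_le)
  moreover have "exp L = \<phi> \<zeta>"
    using phi_partition[where k = n and n = n and p = p and \<zeta> = \<zeta>, OF norm1 p0 mono range order_refl] invariant[of \<zeta>]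
    by (simp add: L a_def pn)
  ultimately show ?thesis by (auto simp: distrib_left)
qed

text \<open>The exponents of \<open>log_phi_approx\<close> for \<open>\<delta> \<rightarrow> 0\<close> converge, while their exponentials all equal \<open>\<phi> \<zeta>\<close>.\<close>

lemma normalised_phi_exponential:
  assumes norm1: "\<phi> 0 = 1"
  shows "\<exists>\<xi>. Q t \<xi> = 0 \<and> f = expvec \<Phi> \<xi>"
proof -
  obtain \<xi> where \<xi>: "\<And>\<zeta>. cinner (\<Phi> [\<zeta>]) f = cinner \<zeta> \<xi>" using one_particle_component by blast
  have "\<phi> \<zeta> = exp (cinner \<zeta> (\<xi> - Q t \<xi>))" for \<zeta>
  proof -
    define C where "C = 2 * (1 + norm f)\<^sup>2 * (norm \<zeta>)\<^sup>2 + norm f * norm \<zeta>"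
    \<comment> \<open>A null sequence that satisfies the smallness conditions of \<open>log_phi_approx\<close> from the start.\<close>
    define \<delta> where "\<delta> k = inverse (real (Suc k)) / 2 / (1 + norm f)" for k
    have pos: "1 + norm f > 0" by (simp add: add_pos_nonneg)
    have \<delta>: "0 < \<delta> k" "\<delta> k \<le> 1" "(1 + norm f) * \<delta> k \<le> 1/2" for k
    proof -
      have inv: "0 < inverse (real (Suc k))" "inverse (real (Suc k)) \<le> 1"
        by (simp_all add: inverse_le_1_iff)
      show "0 < \<delta> k" using inv pos by (simp add: \<delta>_def)
      have "(1 + norm f) * \<delta> k = inverse (real (Suc k)) / 2"
        unfolding \<delta>_def using pos
        by (metis less_irrefl nonzero_mult_div_cancel_left times_divide_eq_right)
      with inv show h: "(1 + norm f) * \<delta> k \<le> 1/2" by linarith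
      have "1 * \<delta> k \<le> (1 + norm f) * \<delta> k" using \<open>0 < \<delta> k\<close> by (intro mult_right_mono) auto
      with h show "\<delta> k \<le> 1" by simp
    qed
    have "\<exists>L. exp L = \<phi> \<zeta> \<and> cmod (L - cinner (\<zeta> - Q t \<zeta>) \<xi>) \<le> \<delta> k * C" for k
      using log_phi_approx[OF norm1 \<xi> \<delta>] unfolding C_def .
    then obtain L where L: "\<And>k. exp (L k) = \<phi> \<zeta>"
      "\<And>k. cmod (L k - cinner (\<zeta> - Q t \<zeta>) \<xi>) \<le> \<delta> k * C" by metis
    have "\<delta> \<longlonglongrightarrow> 0"
      unfolding \<delta>_def by (intro tendsto_divide_zero LIMSEQ_inverse_real_of_nat)
    then have null: "(\<lambda>k. \<delta> k * C) \<longlonglongrightarrow> 0" by (rule tendsto_mult_left_zero)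
    have "(\<lambda>k. L k - cinner (\<zeta> - Q t \<zeta>) \<xi>) \<longlonglongrightarrow> 0"
      by (rule Lim_null_comparison[OF _ null], rule always_eventually, rule allI, rule L(2))
    then have "L \<longlonglongrightarrow> cinner (\<zeta> - Q t \<zeta>) \<xi>" by (rule LIM_zero_cancel)
    then have "(\<lambda>k. exp (L k)) \<longlonglongrightarrow> exp (cinner (\<zeta> - Q t \<zeta>) \<xi>)" by (rule tendsto_exp)
    then have "\<phi> \<zeta> = exp (cinner (\<zeta> - Q t \<zeta>) \<xi>)" by (simp add: L LIMSEQ_const_iff)
    also have "cinner (\<zeta> - Q t \<zeta>) \<xi> = cinner \<zeta> (\<xi> - Q t \<xi>)"
      using t by (simp add: cinner_diff_left cinner_diff_right Q_self_adjoint)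
    finally show ?thesis .
  qed
  then have "f = expvec \<Phi> (\<xi> - Q t \<xi>)"
    by (intro expvec_eqI[OF fock]) (simp add: phi cinner_expvec[OF fock])
  moreover have "Q t (\<xi> - Q t \<xi>) = 0" using t by (simp add: Q_diff Q_Q_le)
  ultimately show ?thesis by blast
qed

end

text \<open>Dividing by the vacuum amplitude reduces to the normalised case. The conjugate appears because the
  amplitude is conjugate-linear in \<open>f\<close>.\<close>

lemma factorising_vector_exponential:
  fixes Q :: "real \<Rightarrow> 'h \<Rightarrow> 'h" and f :: 'f
  defines "\<phi> \<equiv> \<lambda>\<zeta>. cinner (expvec \<Phi> \<zeta>) f"
  assumes path: "projection_path Q t" and f: "f \<noteq> 0"
    and exchange: "\<And>s x y. \<lbrakk>0 \<le> s; s \<le> t\<rbrakk> \<Longrightarrow> \<phi> x * \<phi> y = \<phi> (x - Q s x + Q s y) * \<phi> (y - Q s y + Q s x)"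
    and invariant: "\<And>x. \<phi> (x - Q t x) = \<phi> x"
  obtains c \<xi> where "c \<noteq> 0" "Q t \<xi> = 0" "f = scaleC c (expvec \<Phi> \<xi>)"
proof -
  have \<phi>0: "\<phi> 0 \<noteq> 0"
    by (rule vacuum_amplitude_nonzero[where \<phi> = \<phi> and f = f and Q = Q and t = t,
          OF path _ exchange invariant f]) (simp_all add: \<phi>_def)
  define c where "c = cnj (\<phi> 0)"
  have c: "c \<noteq> 0" "\<phi> 0 = cnj c" using \<phi>0 by (auto simp: c_def)
  define g where "g = scaleC (1 / c) f"
  define \<psi> where "\<psi> = (\<lambda>\<zeta>. cinner (expvec \<Phi> \<zeta>) g)"
  have \<psi>: "\<psi> \<zeta> = \<phi> \<zeta> / cnj c" for \<zeta>
    by (simp add: \<psi>_def g_def \<phi>_def cinner_scaleC_right)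
  have "\<exists>\<xi>. Q t \<xi> = 0 \<and> g = expvec \<Phi> \<xi>"
  proof (rule normalised_phi_exponential[where \<phi> = \<psi>, OF path \<psi>_def])
    show "\<psi> x * \<psi> y = \<psi> (x - Q s x + Q s y) * \<psi> (y - Q s y + Q s x)" if "0 \<le> s" "s \<le> t" for s x y
      using exchange[OF that, of x y] by (simp add: \<psi>)
    show "\<psi> 0 = 1" using c by (simp add: \<psi>)
  qed (simp add: \<psi> invariant)
  then obtain \<xi> where "Q t \<xi> = 0" "g = expvec \<Phi> \<xi>" by blast
  moreover have "f = scaleC c g"
    using c by (simp add: g_def scaleC_scaleC)
  ultimately show ?thesis using c that by blast
qed

end

section \<open>Decomposable vectors\<close>

theorem proposition2p2:
  fixes V :: "real \<Rightarrow> 'h::chilbert_space \<Rightarrow> 'h"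
    and \<Phi> :: "'h list \<Rightarrow> 'f::chilbert_space"
    and \<alpha> :: "real \<Rightarrow> ('f \<Rightarrow> 'f) \<Rightarrow> ('f \<Rightarrow> 'f)"
    and t :: real and x :: "'f \<Rightarrow> 'f"
  assumes "separable_space (euclidean :: 'h topology)"
    and "isometry_semigroup V"
    and "symmetric_fock_space \<Phi>"
    and "ccr_flow \<Phi> V \<alpha>"
    and "t > 0"
    and "x \<in> decomposable_vectors \<alpha> t"
  shows "\<exists>\<xi> c. cadjoint (V t) \<xi> = 0 \<and> c \<noteq> 0 \<and> x = op_scale c (exp_op \<Phi> (V t) \<xi>)"
proof -
  note V = assms(2) and fock = assms(3) and ccr = assms(4) and t = assms(5)
  define Q where "Q s = V s \<circ> cadjoint (V s)" for s
  define f where "f = x (expvec \<Phi> 0)"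
  have path: "projection_path Q t"
    using isometry_semigroup_projection_path[OF V, of t] t by (simp add: Q_def[abs_def])
  have iso: "isometry_op (V s)" if "s \<ge> 0" for s
    using V that by (simp add: isometry_semigroup_def)
  have linear: "linear (V s)" "linear (cadjoint (V s))" if "s \<ge> 0" for s
    using iso[OF that] cadjoint(1)[of "V s"]
    by (auto simp: isometry_op_def intro!: bounded_linear.linear bounded_op_linear)
  have x: "intertwiner \<Phi> (V t) x" and x0: "x \<noteq> (\<lambda>_. 0)"
    using assms(6) product_fibre_intertwiner[OF fock ccr, of t x] t by (auto simp: decomposable_vectors_def)
  have amp: "amplitude \<Phi> x = (\<lambda>\<zeta>. cinner (expvec \<Phi> \<zeta>) f)"
    by (simp add: amplitude_def[abs_def] f_def)
  have shift: "amplitude \<Phi> v (y - Q s y + Q s z) = amplitude \<Phi> v y"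
    if "s \<ge> 0" "intertwiner \<Phi> (V s) v" for s v y z
  proof -
    have "y - Q s y + Q s z = y + V s (cadjoint (V s) z - cadjoint (V s) y)"
      using linear(1)[OF that(1)] by (simp add: Q_def linear_diff)
    then show ?thesis by (simp only: amplitude_shift[OF fock iso[OF that(1)] that(2)])
  qed
  have invariant: "amplitude \<Phi> x (y - Q t y) = amplitude \<Phi> x y" for y
  proof -
    have "Q t 0 = 0" using t linear[of t] by (simp add: Q_def linear_0)
    then show ?thesis using shift[of t x y 0] t x by simp
  qed
  \<comment> \<open>For \<open>0 < s < t\<close> the first factor of \<open>amplitude_comp\<close> ignores \<open>Q s\<close> components and the second ignores all others, so swapping the \<open>Q s\<close> components of two arguments only permutes factors.\<close>
  have exchange: "amplitude \<Phi> x y * amplitude \<Phi> x z =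
      amplitude \<Phi> x (y - Q s y + Q s z) * amplitude \<Phi> x (z - Q s z + Q s y)"
    if s: "0 \<le> s" "s \<le> t" for s y z
  proof -
    consider "s = 0" | "0 < s \<and> s < t" | "s = t" using s by linarith
    then show ?thesis
    proof cases
      case 1
      then show ?thesis using projection_path.Q_0[OF path] by simp
    next
      case 2
      then obtain v w where v: "v \<in> product_fibre \<alpha> s" and xvw: "x = v \<circ> w"
        using assms(6) unfolding decomposable_vectors_def by blast
      have vi: "intertwiner \<Phi> (V s) v" using product_fibre_intertwiner[OF fock ccr s(1) v] .
      have adj: "cadjoint (V s) (y - Q s y + Q s z) = cadjoint (V s) z" for y z
        using linear(2)[OF s(1)] cadjoint_isometry_left_inverse[OF iso[OF s(1)]]
        by (simp add: Q_def linear_diff linear_add)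
      show ?thesis
        unfolding xvw amplitude_comp[OF fock iso[OF s(1)] vi] adj shift[OF s(1) vi] by simp
    next
      case 3
      then show ?thesis using shift[OF s(1)] x by simp
    qed
  qed
  have "f \<noteq> 0"
  proof
    assume "f = 0"
    have bx: "x \<in> bounded_op" using x by (simp add: intertwiner_def)
    have "x = (\<lambda>_. 0)"
    proof (rule bounded_op_eqI_expvec[OF fock bx])
      show "(\<lambda>_. 0) \<in> bounded_op" by (rule bounded_opI[of _ 0]) simp_all
      fix \<eta>
      have "cinner (x (expvec \<Phi> \<eta>)) (expvec \<Phi> \<zeta>) = 0" for \<zeta>
        using t by (simp add: intertwiner_matrix[OF fock iso x] amp \<open>f = 0\<close>)
      then show "x (expvec \<Phi> \<eta>) = 0"
        by (intro expvec_eqI[OF fock]) (metis cinner_commute cinner_zero_right complex_cnj_zero)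
    qed
    then show False using x0 by simp
  qed
  then obtain c \<xi> where c: "c \<noteq> 0" and Q\<xi>: "Q t \<xi> = 0" and f: "f = scaleC c (expvec \<Phi> \<xi>)"
    using factorising_vector_exponential[OF fock path _ exchange[unfolded amp] invariant[unfolded amp]]
    by blast
  have "norm (cadjoint (V t) \<xi>) = norm (Q t \<xi>)"
    using iso[of t] t by (simp add: Q_def isometry_op_def)
  then have \<xi>: "cadjoint (V t) \<xi> = 0" by (simp add: Q\<xi>)
  have "x = op_scale c (exp_op \<Phi> (V t) \<xi>)"
    using t by (intro intertwiner_eq_exp_op[OF fock iso x] f[unfolded f_def] c \<xi>) simp
  then show ?thesis using c \<xi> by blast
qed

end
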